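(* Let $\delta,\gamma$ be fixed parameters with $0<\delta<1/13$ and $0<\gamma<1$, let $s\ge 1$ be an integer, and let $\{\Psi_{\nu}\}_{\nu\in\mathcal{J}}$ be a (bounded) orthonormal system in $L^2(\mathcal{U},d\varrho)$ of finite size $N=\#(\mathcal{J})$, with uniform bound $\Theta=\sup_{\nu\in\mathcal{J}}\|\Psi_\nu\|_{L^\infty(\mathcal{U})}$. Assume that the integer $m$ satisfies $$m \ \ge\ 2^6 e\,\frac{\Theta^2 s}{\delta^2}\log\Big(\frac{\Theta^2 s}{\delta^2}\Big)\max\left\{\frac{2^5}{\delta^4}\log\Big(40\,\frac{\Theta^2 s}{\delta^2}\log\Big(\frac{\Theta^2 s}{\delta^2}\Big)\Big)\log(4N),\ \frac1\delta\log\Big(\frac{1}{\gamma\delta}\log\Big(\frac{\Theta^2 s}{\delta^2}\Big)\Big)\right\},$$ and that $y_1,y_2,\dots,y_m$ are drawn independently from the orthogonalization measure $\varrho$ associated to $\{\Psi_\nu\}$. Then, with probability exceeding $1-\gamma$, the normalized sampling matrix $A\in\mathbb{C}^{m\times N}$ satisfies $$(1-13\delta)\|z\|_2^2<\|Az\|_2^2<(1+13\delta)\|z\|_2^2$$ for all nonzero $z\in\mathbb{C}^N$ with $\#(\mathrm{supp}(z))\le s$.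
   Context: $\mathcal{U}=\prod_{k=1}^d\mathcal{U}_k\subset\mathbb{R}^d$ is a compact product domain equipped with a probability measure $\varrho$, and $\mathcal{J}=\{\nu_1,\dots,\nu_N\}$ is a finite index set. The system $\{\Psi_\nu\}_{\nu\in\mathcal{J}}$ consists of functions $\Psi_\nu:\mathcal{U}\to\mathbb{C}$ that are orthonormal in $L^2(\mathcal{U},d\varrho)$ and bounded ($\Theta<\infty$). The normalized sampling matrix associated with sample points $y_1,\dots,y_m\in\mathcal{U}$ is $$A=\Big(\frac{\Psi_{\nu_j}(y_i)}{\sqrt m}\Big)_{1\le i\le m,\ 1\le j\le N}.$$ For $z\in\mathbb{C}^N$, $\mathrm{supp}(z)$ is the set of indices of nonzero entries of $z$, and $\|\cdot\|_2$ is the Euclidean norm. $\log$ is the natural logarithm. *)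

theory Defs
  imports "HOL-Probability.Probability"
begin

text \<open>
  A compact product domain \<open>U = U\<^sub>1 \<times> \<dots> \<times> U\<^sub>d\<close> in \<open>\<real>\<^sup>d\<close> (with \<open>d = CARD('d)\<close>) carrying a
  probability measure \<open>\<rho>\<close>. The sigma-algebra is only required to contain the Borel subsets
  of \<open>U\<close>, so that both Borel measures and their completions are covered.
\<close>
definition compact_product_prob_space ::
    "('d::finite \<Rightarrow> real set) \<Rightarrow> (real ^ 'd) set \<Rightarrow> (real ^ 'd) measure \<Rightarrow> bool" where
  "compact_product_prob_space Uk U \<rho> \<longleftrightarrow>
     U = {x. \<forall>k. x $ k \<in> Uk k} \<and> compact U \<and>
     prob_space \<rho> \<and> space \<rho> = U \<and> sets (restrict_space borel U) \<subseteq> sets \<rho>"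

definition orthonormal_system :: "'a measure \<Rightarrow> 'i set \<Rightarrow> ('i \<Rightarrow> 'a \<Rightarrow> complex) \<Rightarrow> bool" where
  "orthonormal_system \<rho> J \<Psi> \<longleftrightarrow>
     (\<forall>\<nu>\<in>J. \<Psi> \<nu> \<in> borel_measurable \<rho> \<and> integrable \<rho> (\<lambda>x. (cmod (\<Psi> \<nu> x))\<^sup>2)) \<and>
     (\<forall>\<nu>\<in>J. \<forall>\<mu>\<in>J. (LINT x|\<rho>. \<Psi> \<nu> x * cnj (\<Psi> \<mu> x)) = (if \<nu> = \<mu> then 1 else 0))"

text \<open>
  The supremum of the \<open>L\<^sup>\<infinity>\<close> norms, where the essential supremum is taken with respect to \<open>\<rho>\<close>.
  The value may be \<open>\<infinity>\<close>.
\<close>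
definition uniform_bound :: "'a measure \<Rightarrow> 'i set \<Rightarrow> ('i \<Rightarrow> 'a \<Rightarrow> complex) \<Rightarrow> ereal" where
  "uniform_bound \<rho> J \<Psi> = (SUP \<nu>\<in>J. esssup \<rho> (\<lambda>x. ereal (cmod (\<Psi> \<nu> x))))"

text \<open>The map \<open>\<nu>\<close> enumerates the index set, and \<open>y\<close> lists the \<open>m = CARD('m)\<close> sample points.\<close>
definition sampling_matrix ::
    "('i \<Rightarrow> 'a \<Rightarrow> complex) \<Rightarrow> ('n::finite \<Rightarrow> 'i) \<Rightarrow> ('m::finite \<Rightarrow> 'a) \<Rightarrow> complex ^ 'n ^ 'm" where
  "sampling_matrix \<Psi> \<nu> y =
     (\<chi> i j. \<Psi> (\<nu> j) (y i) / complex_of_real (sqrt (real CARD('m))))"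

definition vec_supp :: "complex ^ 'n::finite \<Rightarrow> 'n set" where
  "vec_supp z = {j. z $ j \<noteq> 0}"

end

theory Submission
  imports Defs
begin

text \<open>
  For a unit vector \<open>z\<close> with at most \<open>s\<close> nonzero entries put \<open>f = (\<Sum>j. z j * \<phi> j)\<close>, so that
  \<open>\<bar>f\<bar>\<^sup>2 \<le> K = \<Theta>\<^sup>2 s\<close>, and compare the mean of \<open>\<bar>f\<bar>\<^sup>2\<close> under the empirical measure with its mean 1 under
  \<open>\<rho>\<close>. Slice \<open>\<bar>f\<bar>\<^sup>2\<close> by the geometric levels \<open>u\<^sub>l = \<delta> (1 + \<delta>)\<^sup>l\<close>, about \<open>ln (K / \<delta>) / \<delta>\<close> of them.
  At level \<open>l\<close> the function \<open>f\<close> is replaced by an average of \<open>t\<^sub>l\<close> functions \<open>2 \<surd>s w \<phi> j\<close> with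
  \<open>w \<in> {1, -1, \<i>, -\<i>}\<close> (Maurey's empirical method): since \<open>z\<close> lies in the convex hull of the corresponding
  vectors, Hoeffding's inequality with \<open>t\<^sub>l\<close> of order \<open>K ln (K / \<delta>) / (\<delta>\<^sup>2 u\<^sub>l)\<close> gives an average that is within
  \<open>\<delta> \<surd>u\<^sub>l\<close> of \<open>f\<close> off a set whose measure is of order \<open>\<delta> / K\<close> under both measures. Only
  \<open>(4 N)^t\<^sub>l\<close> superlevel sets occur at level \<open>l\<close>, and a Chernoff bound with relative error \<open>\<delta>\<close> and additive
  error of order \<open>1 / u\<^sub>l\<close> divided by the number of levels holds for all of them simultaneously:
  \<open>t\<^sub>l\<close> and the Chernoff exponent both scale like \<open>1 / u\<^sub>l\<close>, so every level asks for the same \<open>m\<close>.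
\<close>

section \<open>Maurey's empirical method\<close>

text \<open>Under \<open>Pi_pmf\<close> the coordinates are independent copies of \<open>p\<close>,
  so this is the two-sided Hoeffding inequality for variables with range \<open>{-M..M}\<close>, the
  deviation \<open>a\<close> being counted per draw.\<close>

lemma Hoeffding_Pi_pmf:
  fixes p :: "'v pmf" and h :: "'v \<Rightarrow> real" and t :: nat
  assumes h: "\<And>v. v \<in> set_pmf p \<Longrightarrow> \<bar>h v\<bar> \<le> M" and "M > 0" "t > 0" "a \<ge> 0"
  shows "measure_pmf.prob (Pi_pmf {..<t} d (\<lambda>_. p))
           {x. \<bar>(\<Sum>k<t. h (x k)) - real t * measure_pmf.expectation p h\<bar> \<ge> real t * a}
         \<le> 2 * exp (- (real t * a\<^sup>2 / (2 * M\<^sup>2)))"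
proof -
  let ?P = "Pi_pmf {..<t} d (\<lambda>_. p)"
  have marg: "map_pmf (\<lambda>x. x k) ?P = p" if "k < t" for k
    using that by (simp add: Pi_pmf_component)
  have E: "measure_pmf.expectation ?P (\<lambda>x. h (x k)) = measure_pmf.expectation p h" if "k < t" for k
    using integral_map_pmf[of "\<lambda>x. x k" ?P h] marg[OF that] by simp
  interpret Hoeffding_ineq "measure_pmf ?P" "{..<t}" "\<lambda>k x. h (x k)" "\<lambda>_. - M" "\<lambda>_. M"
    "real t * measure_pmf.expectation p h"
  proof (unfold_locales, goal_cases)
    case 2
    have "prob_space.indep_vars ?P (\<lambda>_. count_space UNIV) (\<lambda>k x. x k) {..<t}"
      by (rule indep_vars_Pi_pmf) simp
    then show ?case
      by (rule prob_space.indep_vars_compose2[OF prob_space_measure_pmf]) auto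
  next
    case (3 i)
    then have "i < t" by simp
    have "AE v in p. h v \<in> {-M..M}"
      using h by (auto simp: AE_measure_pmf_iff abs_le_iff) (metis minus_le_iff)
    then have "AE v in map_pmf (\<lambda>x. x i) ?P. h v \<in> {-M..M}"
      by (simp only: marg[OF \<open>i < t\<close>])
    then show ?case
      by (simp add: AE_measure_pmf_iff)
  qed (simp_all add: E)
  have "measure_pmf.prob ?P {x. \<bar>(\<Sum>k<t. h (x k)) - real t * measure_pmf.expectation p h\<bar> \<ge> real t * a}
     \<le> 2 * exp (-2 * (real t * a)\<^sup>2 / (\<Sum>k<t. (M - (-M))\<^sup>2))"
    using Hoeffding_ineq_abs_ge[of "real t * a"] assms by simp
  also have "-2 * (real t * a)\<^sup>2 / (\<Sum>k<t. (M - (-M))\<^sup>2) = - (real t * a\<^sup>2 / (2 * M\<^sup>2))"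
    using assms by (simp add: field_simps power2_eq_square)
  finally show ?thesis .
qed

lemma cmod_gt_imp_Re_or_Im: "\<tau> < cmod w \<Longrightarrow> \<tau> / 2 \<le> \<bar>Re w\<bar> \<or> \<tau> / 2 \<le> \<bar>Im w\<bar>"
  using cmod_le[of w] by linarith

text \<open>Real and imaginary parts are handled separately, each with deviation
  \<open>\<tau> / 2\<close>: hence the prefactor 4 and the 8 in the exponent.\<close>

lemma Hoeffding_Pi_pmf_complex:
  fixes p :: "'v pmf" and h :: "'v \<Rightarrow> complex" and t :: nat
  assumes fin: "finite (set_pmf p)" and h: "\<And>v. v \<in> set_pmf p \<Longrightarrow> cmod (h v) \<le> M"
    and "M > 0" "t > 0" "\<tau> \<ge> 0"
  shows "measure_pmf.prob (Pi_pmf {..<t} d (\<lambda>_. p))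
           {x. cmod ((\<Sum>k<t. h (x k)) / of_nat t - measure_pmf.expectation p h) > \<tau>}
         \<le> 4 * exp (- (real t * \<tau>\<^sup>2 / (8 * M\<^sup>2)))"
proof -
  let ?P = "Pi_pmf {..<t} d (\<lambda>_. p)"
  let ?A = "\<lambda>g. {x. \<bar>(\<Sum>k<t. g (h (x k))) - real t * measure_pmf.expectation p (\<lambda>v. g (h v))\<bar> \<ge> real t * (\<tau> / 2)}"
  have int: "integrable p h" by (rule integrable_measure_pmf_finite[OF fin])
  have sub: "{x. cmod ((\<Sum>k<t. h (x k)) / of_nat t - measure_pmf.expectation p h) > \<tau>} \<subseteq> ?A Re \<union> ?A Im"
  proof
    fix x assume "x \<in> {x. cmod ((\<Sum>k<t. h (x k)) / of_nat t - measure_pmf.expectation p h) > \<tau>}"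
    then have "\<tau> / 2 \<le> \<bar>Re ((\<Sum>k<t. h (x k)) / of_nat t - measure_pmf.expectation p h)\<bar> \<or>
       \<tau> / 2 \<le> \<bar>Im ((\<Sum>k<t. h (x k)) / of_nat t - measure_pmf.expectation p h)\<bar>"
      by (intro cmod_gt_imp_Re_or_Im) simp
    moreover have "real t * (\<tau> / 2) \<le> \<bar>X - real t * Y\<bar>" if "\<tau> / 2 \<le> \<bar>X / real t - Y\<bar>" for X Y
    proof -
      have "X - real t * Y = real t * (X / real t - Y)" using \<open>t > 0\<close> by (simp add: field_simps)
      then show ?thesis using mult_left_mono[OF that, of "real t"] by (simp only: abs_mult) simp
    qed
    ultimately show "x \<in> ?A Re \<union> ?A Im"
      using int by (auto simp: Re_divide_of_nat Im_divide_of_nat)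
  qed
  have "measure_pmf.prob ?P {x. cmod ((\<Sum>k<t. h (x k)) / of_nat t - measure_pmf.expectation p h) > \<tau>}
     \<le> measure_pmf.prob ?P (?A Re \<union> ?A Im)"
    by (rule measure_pmf.finite_measure_mono[OF sub]) simp
  also have "\<dots> \<le> measure_pmf.prob ?P (?A Re) + measure_pmf.prob ?P (?A Im)"
    by (intro measure_Un_le) auto
  also have "\<dots> \<le> 2 * exp (- (real t * (\<tau>/2)\<^sup>2 / (2 * M\<^sup>2))) + 2 * exp (- (real t * (\<tau>/2)\<^sup>2 / (2 * M\<^sup>2)))"
    using assms abs_Re_le_cmod abs_Im_le_cmod
    by (intro add_mono Hoeffding_Pi_pmf) (auto intro: order_trans)
  also have "\<dots> = 4 * exp (- (real t * \<tau>\<^sup>2 / (8 * M\<^sup>2)))"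
    by (simp add: power_divide)
  finally show ?thesis .
qed

text \<open>First-moment argument: at a fixed point the random average fails with probability at
  most four times the exponential, by Hoeffding. Exchanging the two averages bounds the mean size of
  the bad set by the same number under either measure, so for some \<open>x\<close> the two sizes
  add up to at most twice that number.\<close>

lemma empirical_approximation:
  fixes p :: "'v pmf" and h :: "'v \<Rightarrow> 'a \<Rightarrow> complex" and t :: nat
  assumes fin: "finite V" and p: "set_pmf p \<subseteq> V"
    and bound: "\<And>v y. v \<in> V \<Longrightarrow> y \<in> space \<mu> \<Longrightarrow> cmod (h v y) \<le> M"
    and meas: "\<And>v. v \<in> V \<Longrightarrow> h v \<in> borel_measurable \<mu>"
    and f: "\<And>y. f y = (\<Sum>v\<in>V. complex_of_real (pmf p v) * h v y)"
    and "prob_space \<mu>" "prob_space \<mu>'" and sets: "sets \<mu>' = sets \<mu>"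
    and "M > 0" "t > 0" "\<tau> \<ge> 0"
  defines "bad x \<equiv> {y \<in> space \<mu>. cmod ((\<Sum>k<t. h (x k) y) / of_nat t - f y) > \<tau>}"
  shows "\<exists>x \<in> PiE_dflt {..<t} d (\<lambda>_. V).
           measure \<mu> (bad x) + measure \<mu>' (bad x) \<le> 8 * exp (- (real t * \<tau>\<^sup>2 / (8 * M\<^sup>2)))"
proof -
  interpret \<mu>: prob_space \<mu> by fact
  interpret \<mu>': prob_space \<mu>' by fact
  let ?P = "Pi_pmf {..<t} d (\<lambda>_. p)"
  let ?E = "exp (- (real t * \<tau>\<^sup>2 / (8 * M\<^sup>2)))"
  \<comment> \<open>The random choice lives on a finite set, so its expectations are finite sums and
    exchanging them with integration is linearity of the integral.\<close>
  define W where "W = PiE_dflt {..<t} d (\<lambda>_. V)"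
  have finW: "finite W" unfolding W_def using fin by (intro finite_PiE_dflt) auto
  have PW: "set_pmf ?P \<subseteq> W"
    using p by (auto simp: set_Pi_pmf PiE_dflt_def W_def)
  have fin_p: "finite (set_pmf p)" using fin p by (rule rev_finite_subset)
  have Ep: "measure_pmf.expectation p (\<lambda>v. h v y) = f y" for y
    using fin p by (subst integral_measure_pmf[of V]) (auto simp: f scaleR_conv_of_real)
  have sets_bad: "bad x \<in> sets \<mu>" if "x \<in> W" for x
  proof -
    have [measurable]: "h (x k) \<in> borel_measurable \<mu>" if "k < t" for k
      using \<open>x \<in> W\<close> that by (intro meas) (auto simp: W_def PiE_dflt_def)
    have [measurable]: "f \<in> borel_measurable \<mu>"
      unfolding f[abs_def] using meas by measurable
    show ?thesis unfolding bad_def by measurable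
  qed
  have pointwise: "(\<Sum>x\<in>W. pmf ?P x * indicator (bad x) y) \<le> 4 * ?E" if y: "y \<in> space \<mu>" for y
  proof -
    have "(\<Sum>x\<in>W. pmf ?P x * indicator (bad x) y) = sum (pmf ?P) (W \<inter> {x. y \<in> bad x})"
      using finW by (simp add: sum.inter_restrict indicator_def if_distrib cong: if_cong)
    also have "\<dots> = measure_pmf.prob ?P (W \<inter> {x. y \<in> bad x})"
      using finW by (simp add: measure_measure_pmf_finite)
    also have "\<dots> \<le> measure_pmf.prob ?P {x. cmod ((\<Sum>k<t. h (x k) y) / of_nat t - measure_pmf.expectation p (\<lambda>v. h v y)) > \<tau>}"
      by (rule measure_pmf.finite_measure_mono) (auto simp: bad_def Ep)
    also have "\<dots> \<le> 4 * ?E"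
      using assms fin_p y by (intro Hoeffding_Pi_pmf_complex) auto
    finally show ?thesis .
  qed
  have avg: "(\<Sum>x\<in>W. pmf ?P x * measure m (bad x)) \<le> 4 * ?E"
    if m: "prob_space m" "sets m = sets \<mu>" for m
  proof -
    interpret m: prob_space m by fact
    have sp: "space m = space \<mu>" using m(2) by (rule sets_eq_imp_space_eq)
    have sb: "bad x \<in> sets m" if "x \<in> W" for x using sets_bad[OF that] m(2) by simp
    have "(\<Sum>x\<in>W. pmf ?P x * measure m (bad x)) = (\<Sum>x\<in>W. \<integral>y. pmf ?P x * indicator (bad x) y \<partial>m)"
      using sb by (intro sum.cong) auto
    also have "\<dots> = (\<integral>y. (\<Sum>x\<in>W. pmf ?P x * indicator (bad x) y) \<partial>m)"
      using sb by (subst Bochner_Integration.integral_sum) (auto simp: less_top[symmetric])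
    also have "\<dots> \<le> (\<integral>y. 4 * ?E \<partial>m)"
      using sb pointwise sp by (intro integral_mono) (auto simp: less_top[symmetric])
    also have "\<dots> = 4 * ?E" by (simp add: m.prob_space)
    finally show ?thesis .
  qed
  show ?thesis
  proof (rule ccontr)
    assume "\<not> ?thesis"
    then have gt: "measure \<mu> (bad x) + measure \<mu>' (bad x) > 8 * ?E" if "x \<in> W" for x
      using that by (auto simp: W_def not_le)
    have one: "sum (pmf ?P) W = 1" by (rule sum_pmf_eq_1[OF finW PW])
    \<comment> \<open>A point of positive weight makes the averaged inequality strict.\<close>
    then obtain x0 where x0: "x0 \<in> W" "pmf ?P x0 > 0"
      by (metis (no_types, lifting) not_less pmf_nonneg dual_order.antisym sum.neutral zero_neq_one)
    have "8 * ?E = (\<Sum>x\<in>W. pmf ?P x * (8 * ?E))"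
      using one by (simp add: sum_distrib_right[symmetric])
    also have "\<dots> < (\<Sum>x\<in>W. pmf ?P x * (measure \<mu> (bad x) + measure \<mu>' (bad x)))"
      using x0 gt by (intro sum_strict_mono_ex1[OF finW])
        (auto intro!: mult_left_mono bexI[of _ x0] simp: less_imp_le)
    also have "\<dots> \<le> 4 * ?E + 4 * ?E"
      using avg[of \<mu>] avg[of \<mu>'] assms by (simp add: distrib_left sum.distrib)
    finally show False by simp
  qed
qed

section \<open>Coefficient vectors as means of rotated coordinate vectors\<close>

definition quarter_turns :: "complex set" where
  "quarter_turns = {1, - 1, \<i>, - \<i>}"

lemma sum_quarter_turns:
  "(\<Sum>w\<in>quarter_turns. F w) = F 1 + F (- 1) + F \<i> + F (- \<i>)"
proof -
  have "1 \<noteq> (- 1 :: complex)" "1 \<noteq> \<i>" "1 \<noteq> - \<i>" "- 1 \<noteq> \<i>" "- 1 \<noteq> - \<i>" "\<i> \<noteq> - \<i>"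
    by (simp_all add: complex_eq_iff)
  then show ?thesis by (simp add: quarter_turns_def add.assoc)
qed

lemma finite_quarter_turns [simp]: "finite quarter_turns"
  by (simp add: quarter_turns_def)

lemma card_quarter_turns: "card quarter_turns = 4"
  using sum_quarter_turns[of "\<lambda>_. 1 :: nat"] by simp

lemma norm_quarter_turns: "w \<in> quarter_turns \<Longrightarrow> cmod w = 1"
  by (auto simp: quarter_turns_def)

text \<open>The weight of \<open>w\<close> at \<open>j\<close> comes from the positive part of the
  component of \<open>z j\<close> in direction \<open>w\<close>; opposite directions together
  restore the real and the imaginary part. The scale is \<open>2 * c\<close> because the moduli of
  the two parts add up to at most twice the modulus, and the weights must fit into total mass
  1.\<close>

lemma exists_vertex_pmf:
  fixes z :: "'n::finite \<Rightarrow> complex"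
  assumes c: "c > 0" and z: "(\<Sum>j\<in>UNIV. cmod (z j)) \<le> c"
  obtains p :: "('n \<times> complex) pmf" where "set_pmf p \<subseteq> UNIV \<times> quarter_turns"
    "\<And>j. (\<Sum>w\<in>quarter_turns. complex_of_real (pmf p (j, w)) * (complex_of_real (2 * c) * w)) = z j"
proof -
  \<comment> \<open>The remaining mass is spread evenly: the four directions \<open>w\<close> sum to zero, so it does not move the mean.\<close>
  define slack where "slack = (1 - (\<Sum>j\<in>UNIV. \<bar>Re (z j)\<bar> + \<bar>Im (z j)\<bar>) / (2 * c)) / (4 * real CARD('n))"
  define q where "q v = (if snd v \<in> quarter_turns
      then max 0 (Re (cnj (snd v) * z (fst v))) / (2 * c) + slack else 0)" for v :: "'n \<times> complex"
  have "(\<Sum>j\<in>UNIV. \<bar>Re (z j)\<bar> + \<bar>Im (z j)\<bar>) \<le> (\<Sum>j\<in>UNIV. 2 * cmod (z j))"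
    using abs_Re_le_cmod abs_Im_le_cmod by (intro sum_mono) (metis add_mono mult_2)
  also have "\<dots> \<le> 2 * c" using z by (simp add: sum_distrib_left[symmetric])
  finally have slack: "slack \<ge> 0" using c by (simp add: slack_def)
  have q_nonneg: "q v \<ge> 0" for v using c slack by (simp add: q_def)
  have q_sum: "(\<Sum>w\<in>quarter_turns. q (j, w)) = (\<bar>Re (z j)\<bar> + \<bar>Im (z j)\<bar>) / (2 * c) + 4 * slack" for j
  proof -
    have "(\<Sum>w\<in>quarter_turns. q (j, w)) = (\<Sum>w\<in>quarter_turns. max 0 (Re (cnj w * z j)) / (2 * c) + slack)"
      by (intro sum.cong) (auto simp: q_def)
    also have "\<dots> = (\<bar>Re (z j)\<bar> + \<bar>Im (z j)\<bar>) / (2 * c) + 4 * slack"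
      unfolding sum_quarter_turns using c by (simp add: field_simps max_def abs_if)
    finally show ?thesis .
  qed
  have supp: "q v = 0" if "v \<notin> UNIV \<times> quarter_turns" for v
    using that by (auto simp: q_def mem_Times_iff)
  have "(\<Sum>v\<in>UNIV \<times> quarter_turns. q v) = (\<Sum>j\<in>UNIV. \<Sum>w\<in>quarter_turns. q (j, w))"
    by (subst sum.cartesian_product) simp
  also have "\<dots> = (\<Sum>j\<in>UNIV. \<bar>Re (z j)\<bar> + \<bar>Im (z j)\<bar>) / (2 * c) + real CARD('n) * (4 * slack)"
    unfolding q_sum sum.distrib sum_divide_distrib[symmetric] by simp
  also have "\<dots> = 1"
  proof -
    have "a + n * (4 * ((1 - a) / (4 * n))) = 1" if "n \<noteq> 0" for a n :: real
      using that by (simp add: field_simps)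
    then show ?thesis unfolding slack_def by this simp
  qed
  finally have q_total: "(\<Sum>v\<in>UNIV \<times> quarter_turns. q v) = 1" .
  have "(\<integral>\<^sup>+v. ennreal (q v) \<partial>count_space UNIV) = (\<Sum>v\<in>UNIV \<times> quarter_turns. ennreal (q v))"
    by (intro nn_integral_count_space') (use supp in auto)
  also have "\<dots> = 1" by (simp add: q_nonneg q_total)
  finally have pmf_q: "pmf (embed_pmf q) v = q v" for v
    by (intro pmf_embed_pmf q_nonneg)
  show thesis
  proof
    show "set_pmf (embed_pmf q) \<subseteq> UNIV \<times> quarter_turns"
      using supp by (fastforce simp: set_pmf_eq pmf_q)
    fix j
    have "(\<Sum>w\<in>quarter_turns. complex_of_real (pmf (embed_pmf q) (j, w)) * (complex_of_real (2 * c) * w)) =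
      (\<Sum>w\<in>quarter_turns. complex_of_real (max 0 (Re (cnj w * z j)) + 2 * c * slack) * w)"
      using c by (intro sum.cong) (auto simp: pmf_q q_def field_simps simp flip: of_real_mult)
    also have "\<dots> = z j"
      unfolding sum_quarter_turns using c by (simp add: complex_eq_iff max_def)
    finally show "(\<Sum>w\<in>quarter_turns. complex_of_real (pmf (embed_pmf q) (j, w)) * (complex_of_real (2 * c) * w)) = z j" .
  qed
qed

definition vertex :: "real \<Rightarrow> ('n \<Rightarrow> 'a \<Rightarrow> complex) \<Rightarrow> 'n \<times> complex \<Rightarrow> 'a \<Rightarrow> complex" where
  "vertex c \<phi> v y = complex_of_real (2 * c) * snd v * \<phi> (fst v) y"

definition vertex_mean ::
    "real \<Rightarrow> ('n \<Rightarrow> 'a \<Rightarrow> complex) \<Rightarrow> nat \<Rightarrow> (nat \<Rightarrow> 'n \<times> complex) \<Rightarrow> 'a \<Rightarrow> complex" where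
  "vertex_mean c \<phi> t x y = (\<Sum>k<t. vertex c \<phi> (x k) y) / of_nat t"

text \<open>Outside \<open>{..<t}\<close> the value is pinned to \<open>undefined\<close>; this
  makes the set finite, and its cardinality enters the union bound.\<close>

definition samples :: "nat \<Rightarrow> (nat \<Rightarrow> 'n::finite \<times> complex) set" where
  "samples t = PiE_dflt {..<t} undefined (\<lambda>_. UNIV \<times> quarter_turns)"

lemma finite_samples [simp]: "finite (samples t)"
  unfolding samples_def by (intro finite_PiE_dflt) auto

lemma card_samples: "card (samples t :: (nat \<Rightarrow> 'n::finite \<times> complex) set) = (4 * CARD('n)) ^ t"
  unfolding samples_def by (subst card_PiE_dflt) (auto simp: card_cartesian_product card_quarter_turns)

lemma borel_measurable_vertex_mean:
  assumes "\<And>j. \<phi> j \<in> borel_measurable \<mu>"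
  shows "vertex_mean c \<phi> t x \<in> borel_measurable \<mu>"
  using assms unfolding vertex_mean_def[abs_def] vertex_def by measurable

text \<open>The family \<open>samples t\<close> depends on neither \<open>z\<close> nor the
  measures; only the choice inside it does. One \<open>x\<close> serves both measures, since each
  bad set is bounded by the sum of the two. The exponent contains the square of the sup bound
  \<open>2 * c * \<Theta>\<close> of the vertices.\<close>

lemma sparse_approximation:
  fixes \<phi> :: "'n::finite \<Rightarrow> 'a \<Rightarrow> complex" and z :: "'n \<Rightarrow> complex"
  assumes "prob_space \<mu>" "prob_space \<mu>'" "sets \<mu>' = sets \<mu>"
    and meas: "\<And>j. \<phi> j \<in> borel_measurable \<mu>"
    and bound: "\<And>j y. y \<in> space \<mu> \<Longrightarrow> cmod (\<phi> j y) \<le> \<Theta>" and \<Theta>: "0 < \<Theta>"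
    and c: "0 < c" "(\<Sum>j\<in>UNIV. cmod (z j)) \<le> c" and t: "0 < t" and \<tau>: "0 \<le> \<tau>"
  obtains x where "x \<in> samples t"
    "measure \<mu> {y \<in> space \<mu>. cmod (vertex_mean c \<phi> t x y - (\<Sum>j\<in>UNIV. z j * \<phi> j y)) > \<tau>}
       \<le> 8 * exp (- (real t * \<tau>\<^sup>2 / (8 * (4 * (c\<^sup>2 * \<Theta>\<^sup>2)))))"
    "measure \<mu>' {y \<in> space \<mu>. cmod (vertex_mean c \<phi> t x y - (\<Sum>j\<in>UNIV. z j * \<phi> j y)) > \<tau>}
       \<le> 8 * exp (- (real t * \<tau>\<^sup>2 / (8 * (4 * (c\<^sup>2 * \<Theta>\<^sup>2)))))"
proof -
  obtain p :: "('n \<times> complex) pmf" where p: "set_pmf p \<subseteq> UNIV \<times> quarter_turns"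
    "\<And>j. (\<Sum>w\<in>quarter_turns. complex_of_real (pmf p (j, w)) * (complex_of_real (2 * c) * w)) = z j"
    using exists_vertex_pmf[OF c] by metis
  have f: "(\<Sum>j\<in>UNIV. z j * \<phi> j y) = (\<Sum>v\<in>UNIV \<times> quarter_turns. complex_of_real (pmf p v) * vertex c \<phi> v y)" for y
  proof -
    have "(\<Sum>v\<in>UNIV \<times> quarter_turns. complex_of_real (pmf p v) * vertex c \<phi> v y) =
       (\<Sum>j\<in>UNIV. \<Sum>w\<in>quarter_turns. complex_of_real (pmf p (j, w)) * vertex c \<phi> (j, w) y)"
      by (subst sum.cartesian_product) simp
    also have "\<dots> = (\<Sum>j\<in>UNIV. z j * \<phi> j y)"
      unfolding p(2)[symmetric] sum_distrib_right by (intro sum.cong) (auto simp: vertex_def mult_ac)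
    finally show ?thesis by simp
  qed
  have vertex_bound: "cmod (vertex c \<phi> v y) \<le> 2 * c * \<Theta>" if "v \<in> UNIV \<times> quarter_turns" "y \<in> space \<mu>" for v y
    using that bound[of y "fst v"] norm_quarter_turns[of "snd v"] c
    by (auto simp: vertex_def norm_mult mem_Times_iff)
  have vertex_meas: "vertex c \<phi> v \<in> borel_measurable \<mu>" for v
    unfolding vertex_def[abs_def] using meas by measurable
  obtain x where x: "x \<in> samples t"
    "measure \<mu> {y \<in> space \<mu>. cmod (vertex_mean c \<phi> t x y - (\<Sum>j\<in>UNIV. z j * \<phi> j y)) > \<tau>} +
     measure \<mu>' {y \<in> space \<mu>. cmod (vertex_mean c \<phi> t x y - (\<Sum>j\<in>UNIV. z j * \<phi> j y)) > \<tau>}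
       \<le> 8 * exp (- (real t * \<tau>\<^sup>2 / (8 * (2 * c * \<Theta>)\<^sup>2)))"
    using empirical_approximation[of "UNIV \<times> quarter_turns" p \<mu> "vertex c \<phi>" "2 * c * \<Theta>" _ \<mu>' t \<tau> undefined,
        OF _ p(1) vertex_bound vertex_meas f assms(1-3) _ t \<tau>] c \<Theta>
    by (auto simp: samples_def vertex_mean_def)
  have "(2 * c * \<Theta>)\<^sup>2 = 4 * (c\<^sup>2 * \<Theta>\<^sup>2)" by (simp add: power_mult_distrib)
  note le = x(2)[unfolded this]
  show thesis
    by (rule that[OF x(1)]; rule order_trans[OF _ le]) simp_all
qed

section \<open>A Chernoff bound for frequencies\<close>

text \<open>For negative \<open>c\<close>, multiply by \<open>1 - c > 0\<close>: then
  \<open>exp c * (1 - c) \<le> 1\<close>, and \<open>1 - c ^ 3\<close> factors as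
  \<open>(1 + c + c\<^sup>2) * (1 - c)\<close>.\<close>

lemma exp_le_quadratic:
  fixes c :: real
  assumes "\<bar>c\<bar> \<le> 1"
  shows "exp c \<le> 1 + c + c\<^sup>2"
proof (cases "c \<ge> 0")
  case True
  then show ?thesis using exp_bound[of c] assms by simp
next
  case False
  have "exp c * (1 - c) \<le> exp c * exp (- c)"
    using exp_ge_add_one_self[of "- c"] by (intro mult_left_mono) auto
  also have "\<dots> = 1" by (simp add: exp_minus)
  also have "1 \<le> 1 - c * c\<^sup>2"
    using False by (simp add: mult_nonpos_nonneg)
  also have "\<dots> = (1 + c + c\<^sup>2) * (1 - c)" by (simp add: algebra_simps power2_eq_square)
  finally show ?thesis using False by (simp add: mult_le_cancel_right)
qed

text \<open>Exponential Markov inequality with a parameter \<open>c\<close> of either sign, so that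
  it yields both tails. The quadratic bound on \<open>exp\<close> makes the second-order term
  proportional to \<open>measure \<rho> B\<close>, which is what permits a relative error.\<close>

lemma (in prob_space) Chernoff_indicator:
  fixes y :: "'m::finite \<Rightarrow> 'a \<Rightarrow> 'b"
  assumes indep: "indep_vars (\<lambda>_. \<rho>) y UNIV"
    and distr: "\<And>i. distr M \<rho> (y i) = \<rho>"
    and B: "B \<in> sets \<rho>" and c: "\<bar>c\<bar> \<le> 1"
  shows "prob {\<omega> \<in> space M. c * (\<Sum>i\<in>UNIV. indicator B (y i \<omega>)) \<ge>
            real CARD('m) * (c * measure \<rho> B + c\<^sup>2 * measure \<rho> B + e)}
         \<le> exp (- (real CARD('m) * e))"
proof -
  have y[measurable]: "y i \<in> M \<rightarrow>\<^sub>M \<rho>" for i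
    using indep by (auto simp: indep_vars_def)
  note B[measurable]
  interpret \<rho>: prob_space \<rho>
    using prob_space_distr[OF y] distr by metis
  let ?p = "measure \<rho> B"
  define X where "X i \<omega> = exp (c * indicator B (y i \<omega>))" for i \<omega>
  \<comment> \<open>An indicator takes only the values 0 and 1, so its exponential is affine in
    it.\<close>
  have X: "X i \<omega> = 1 + (exp c - 1) * indicator B (y i \<omega>)" for i \<omega>
    by (auto simp: X_def indicator_def)
  have indepX: "indep_vars (\<lambda>_. borel) X UNIV"
    unfolding X_def[abs_def] by (rule indep_vars_compose2[OF indep]) measurable
  have int_ind: "integrable M (\<lambda>\<omega>. indicator B (y i \<omega>) :: real)" for i
    by (rule integrable_const_bound[of _ 1]) auto
  then have intX: "integrable M (X i)" for i
    unfolding X[abs_def]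
    by (intro Bochner_Integration.integrable_add integrable_mult_right integrable_const)
  have "expectation (\<lambda>\<omega>. indicator B (y i \<omega>)) = ?p" for i
    using integral_distr[OF y, of "indicator B :: 'b \<Rightarrow> real" i] distr[of i] by simp
  then have EX: "expectation (X i) = 1 + (exp c - 1) * ?p" for i
    unfolding X[abs_def] by (subst Bochner_Integration.integral_add) (auto simp: prob_space intro!: integrable_mult_right int_ind)
  have prodX: "(\<Prod>i\<in>UNIV. X i \<omega>) = exp (c * (\<Sum>i\<in>UNIV. indicator B (y i \<omega>)))" for \<omega>
    unfolding X_def by (simp only: sum_distrib_left exp_sum[OF finite])
  let ?a = "real CARD('m) * (c * ?p + c\<^sup>2 * ?p + e)"
  have nonneg: "0 \<le> 1 + (exp c - 1) * ?p"
  proof -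
    have "0 \<le> (1 - ?p) + exp c * ?p" by (intro add_nonneg_nonneg) auto
    then show ?thesis by (simp add: algebra_simps)
  qed
  have "prob {\<omega> \<in> space M. c * (\<Sum>i\<in>UNIV. indicator B (y i \<omega>)) \<ge> ?a}
      = prob {\<omega> \<in> space M. (\<Prod>i\<in>UNIV. X i \<omega>) \<ge> exp ?a}"
    by (simp only: prodX exp_le_cancel_iff)
  also have "\<dots> \<le> expectation (\<lambda>\<omega>. \<Prod>i\<in>UNIV. X i \<omega>) / exp ?a"
    by (intro integral_Markov_inequality_measure[where A = "space M"]
          indep_vars_integrable[OF _ indepX] intX) (auto simp: prodX)
  also have "expectation (\<lambda>\<omega>. \<Prod>i\<in>UNIV. X i \<omega>) = (1 + (exp c - 1) * ?p) ^ CARD('m)"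
    by (subst indep_vars_lebesgue_integral[OF _ indepX intX]) (auto simp: EX)
  also have "\<dots> \<le> exp ((c + c\<^sup>2) * ?p) ^ CARD('m)"
  proof (intro power_mono nonneg)
    have "(exp c - 1) * ?p \<le> (c + c\<^sup>2) * ?p"
      using exp_le_quadratic[OF c] by (intro mult_right_mono) auto
    also have "1 + \<dots> \<le> exp ((c + c\<^sup>2) * ?p)" by (rule exp_ge_add_one_self)
    finally show "1 + (exp c - 1) * ?p \<le> exp ((c + c\<^sup>2) * ?p)" by simp
  qed
  also have "exp ((c + c\<^sup>2) * ?p) ^ CARD('m) / exp ?a = exp (- (real CARD('m) * e))"
    by (simp add: exp_of_nat_mult[symmetric] exp_diff[symmetric] algebra_simps)
  finally show ?thesis by (simp add: divide_right_mono)
qed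

text \<open>Take \<open>c = d\<close> and \<open>c = - d\<close>. Multiplying the deviation by
  \<open>d\<close> turns its relative part into the quadratic term, so the exponent keeps
  \<open>d * e\<close>, which is linear in the additive error \<open>e\<close>. With
  \<open>e\<close> of order the inverse level, the exponent scales in the same way.\<close>

lemma (in prob_space) Chernoff_frequency:
  fixes y :: "'m::finite \<Rightarrow> 'a \<Rightarrow> 'b"
  assumes indep: "indep_vars (\<lambda>_. \<rho>) y UNIV"
    and distr: "\<And>i. distr M \<rho> (y i) = \<rho>"
    and B: "B \<in> sets \<rho>" and d: "0 < d" "d \<le> 1"
  shows "prob {\<omega> \<in> space M. \<bar>(\<Sum>i\<in>UNIV. indicator B (y i \<omega>)) / real CARD('m) - measure \<rho> B\<bar> >
            d * measure \<rho> B + e}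
         \<le> 2 * exp (- (real CARD('m) * d * e))"
proof -
  have y[measurable]: "y i \<in> M \<rightarrow>\<^sub>M \<rho>" for i
    using indep by (auto simp: indep_vars_def)
  note B[measurable]
  let ?p = "measure \<rho> B" and ?m = "real CARD('m)"
  let ?S = "\<lambda>\<omega>. (\<Sum>i\<in>UNIV. indicator B (y i \<omega>)) :: real"
  let ?T = "\<lambda>c. {\<omega> \<in> space M. c * ?S \<omega> \<ge> ?m * (c * ?p + c\<^sup>2 * ?p + d * e)}"
  have "{\<omega> \<in> space M. \<bar>?S \<omega> / ?m - ?p\<bar> > d * ?p + e} \<subseteq> ?T d \<union> ?T (- d)"
  proof
    fix \<omega> assume \<omega>: "\<omega> \<in> {\<omega> \<in> space M. \<bar>?S \<omega> / ?m - ?p\<bar> > d * ?p + e}"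
    define q where "q = ?S \<omega> / ?m"
    have S: "?S \<omega> = ?m * q" by (simp add: q_def)
    have "d * ?p + e \<le> q - ?p \<or> d * ?p + e \<le> ?p - q"
      using \<omega> by (auto simp: q_def)
    then show "\<omega> \<in> ?T d \<union> ?T (- d)"
    proof
      assume "d * ?p + e \<le> q - ?p"
      then have "?m * d * (d * ?p + e) \<le> ?m * d * (q - ?p)"
        using d by (intro mult_left_mono) auto
      then have "?m * (d * ?p + d\<^sup>2 * ?p + d * e) \<le> d * ?S \<omega>"
        unfolding S by (simp add: algebra_simps power2_eq_square)
      then show ?thesis using \<omega> by simp
    next
      assume "d * ?p + e \<le> ?p - q"
      then have "?m * d * (d * ?p + e) \<le> ?m * d * (?p - q)"
        using d by (intro mult_left_mono) auto
      then have "?m * (- d * ?p + (- d)\<^sup>2 * ?p + d * e) \<le> - d * ?S \<omega>"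
        unfolding S by (simp add: algebra_simps power2_eq_square)
      then show ?thesis using \<omega> by simp
    qed
  qed
  then have "prob {\<omega> \<in> space M. \<bar>?S \<omega> / ?m - ?p\<bar> > d * ?p + e} \<le> prob (?T d \<union> ?T (- d))"
    by (rule finite_measure_mono) measurable
  also have "\<dots> \<le> prob (?T d) + prob (?T (- d))"
    by (intro measure_Un_le) measurable
  also have "\<dots> \<le> exp (- (?m * (d * e))) + exp (- (?m * (d * e)))"
    using d by (intro add_mono Chernoff_indicator[OF indep distr B]) auto
  finally show ?thesis by (simp add: mult.assoc)
qed

section \<open>Slicing the second moment\<close>

definition level :: "real \<Rightarrow> nat \<Rightarrow> real" where
  "level d l = d * (1 + d) ^ l"

text \<open>The weight \<open>d * level d l\<close> is the gap between the levels \<open>l\<close>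
  and \<open>l + 1\<close>: this is a discretized layer-cake integral when \<open>A l\<close> is the
  superlevel set at \<open>level d l\<close>.\<close>

definition level_sum :: "real \<Rightarrow> nat \<Rightarrow> (nat \<Rightarrow> 'a set) \<Rightarrow> 'a \<Rightarrow> real" where
  "level_sum d L A y = (\<Sum>l<L. d * level d l * indicator (A l) y)"

lemma level_0 [simp]: "level d 0 = d"
  by (simp add: level_def)

lemma level_Suc: "level d (Suc l) = (1 + d) * level d l"
  by (simp add: level_def)

lemma level_pos: "d > 0 \<Longrightarrow> level d l > 0"
  by (simp add: level_def)

lemma sum_level: "(\<Sum>l<L. d * level d l) = level d L - d"
  by (induction L) (simp_all add: level_Suc algebra_simps)

text \<open>If \<open>w\<close> exceeds every level used, all weights count and telescope to the top
  level minus \<open>d\<close>; the loss \<open>d\<close> is the part of \<open>w\<close> below the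
  lowest level.\<close>

lemma layer_cake_lower:
  assumes "d > 0" "w \<le> level d L"
  shows "w - d \<le> (\<Sum>l<L. d * level d l * of_bool (level d l < w))"
  using assms(2)
proof (induction L)
  case (Suc L)
  show ?case
  proof (cases "w \<le> level d L")
    case True
    then show ?thesis using Suc.IH by simp
  next
    case False
    have mono: "level d l \<le> level d L" if "l < Suc L" for l
      using that \<open>d > 0\<close> by (auto simp: level_def intro!: mult_left_mono power_increasing)
    have "(\<Sum>l<Suc L. d * level d l * of_bool (level d l < w)) = (\<Sum>l<Suc L. d * level d l)"
      using False mono by (intro sum.cong refl) (fastforce simp: not_le)
    then show ?thesis using Suc.prems by (simp only: sum_level)
  qed
qed simp

text \<open>The weights up to the highest level below \<open>w\<close> telescope to less than the
  next level, which is larger by the factor \<open>1 + d\<close> only.\<close>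

lemma layer_cake_upper:
  assumes "d > 0" "w \<ge> 0"
  shows "(\<Sum>l<L. d * level d l * of_bool (level d l < w)) \<le> (1 + d) * w"
proof (induction L)
  case (Suc L)
  show ?case
  proof (cases "level d L < w")
    case True
    have "(\<Sum>l<Suc L. d * level d l * of_bool (level d l < w)) \<le> (\<Sum>l<Suc L. d * level d l)"
      using level_pos[OF \<open>d > 0\<close>] \<open>d > 0\<close> by (intro sum_mono) (auto simp: less_imp_le)
    also have "\<dots> \<le> (1 + d) * level d L"
      unfolding sum_level using \<open>d > 0\<close> by (simp add: level_Suc)
    also have "\<dots> \<le> (1 + d) * w" using True \<open>d > 0\<close> by simp
    finally show ?thesis .
  qed (use Suc in simp)
qed (use assms in simp)

section \<open>Superlevel sets of the approximants against the second moment, for one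
  measure\<close>

context
  fixes \<mu> :: "'a measure" and f :: "'a \<Rightarrow> complex" and g :: "nat \<Rightarrow> 'a \<Rightarrow> complex"
    and d K \<epsilon> :: real and L :: nat
  assumes \<mu>: "prob_space \<mu>" and d: "0 < d" "d < 1"
    and f_meas[measurable]: "f \<in> borel_measurable \<mu>"
    and f_bound: "\<And>y. y \<in> space \<mu> \<Longrightarrow> (cmod (f y))\<^sup>2 \<le> K"
    and L: "K \<le> level d L"
    and g_meas[measurable]: "\<And>l. l < L \<Longrightarrow> g l \<in> borel_measurable \<mu>"
    and bad: "\<And>l. l < L \<Longrightarrow>
      measure \<mu> {y \<in> space \<mu>. cmod (g l y - f y) > d * sqrt (level d l)} \<le> \<epsilon>"
begin

interpretation prob_space \<mu> by (rule \<mu>)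

private abbreviation B where "B l \<equiv> {y \<in> space \<mu>. level d l < (cmod (g l y))\<^sup>2}"
private abbreviation bd where "bd l \<equiv> {y \<in> space \<mu>. cmod (g l y - f y) > d * sqrt (level d l)}"

text \<open>Off the bad set \<open>g l y\<close> is within \<open>d * r\<close> of
  \<open>f y\<close>, where \<open>r\<^sup>2\<close> is the level; thus
  \<open>cmod (g l y) \<le> r\<close> would force
  \<open>cmod (f y) \<le> (1 + d) * r\<close>.\<close>

private lemma f_large:
  assumes "y \<in> space \<mu>" "level d l < (cmod (f y))\<^sup>2 / (1 + d)\<^sup>2"
  shows "y \<in> B l \<or> y \<in> bd l"
proof (rule ccontr)
  define r where "r = sqrt (level d l)"
  have r: "r > 0" "level d l = r\<^sup>2" using level_pos[OF d(1)] by (auto simp: r_def less_imp_le)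
  assume "\<not> ?thesis"
  then have g: "(cmod (g l y))\<^sup>2 \<le> r\<^sup>2" "cmod (g l y - f y) \<le> d * r"
    using assms(1) by (auto simp: r_def[symmetric] r(2)[symmetric])
  have "cmod (f y) \<le> cmod (g l y) + cmod (g l y - f y)"
    using norm_triangle_sub[of "f y" "g l y"] by (simp add: norm_minus_commute)
  also have "\<dots> \<le> (1 + d) * r"
    using g power2_le_imp_le[OF g(1)] r by (simp add: algebra_simps)
  finally have "(cmod (f y))\<^sup>2 \<le> ((1 + d) * r)\<^sup>2" by (intro power_mono) auto
  then have "(cmod (f y))\<^sup>2 / (1 + d)\<^sup>2 \<le> r\<^sup>2"
    using d by (simp add: power_mult_distrib divide_le_eq mult.commute)
  then show False using assms(2) r(2) by simp
qed

text \<open>Counterpart of \<open>f_large\<close>: when \<open>cmod (f y) \<le> (1 - d) * r\<close>,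
  there is room for the approximation error \<open>d * r\<close>.\<close>

private lemma g_large:
  assumes "y \<in> B l"
  shows "level d l < (cmod (f y))\<^sup>2 / (1 - d)\<^sup>2 \<or> y \<in> bd l"
proof (rule ccontr)
  define r where "r = sqrt (level d l)"
  have r: "r > 0" "level d l = r\<^sup>2" using level_pos[OF d(1)] by (auto simp: r_def less_imp_le)
  assume "\<not> ?thesis"
  then have f: "(cmod (f y))\<^sup>2 / (1 - d)\<^sup>2 \<le> r\<^sup>2" "cmod (g l y - f y) \<le> d * r"
    using assms(1) by (auto simp: r_def[symmetric] r(2)[symmetric])
  have "(cmod (f y))\<^sup>2 \<le> ((1 - d) * r)\<^sup>2"
    using f(1) d by (simp add: power_mult_distrib divide_le_eq mult.commute)
  then have "cmod (f y) \<le> (1 - d) * r" by (rule power2_le_imp_le) (use d r in simp)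
  moreover have "cmod (g l y) \<le> cmod (f y) + cmod (g l y - f y)"
    by (rule norm_triangle_sub)
  ultimately have "cmod (g l y) \<le> r" using f(2) by (simp add: algebra_simps)
  then have "(cmod (g l y))\<^sup>2 \<le> r\<^sup>2" by (intro power_mono) auto
  then show False using assms r(2) by simp
qed

private lemma integrable_f: "integrable \<mu> (\<lambda>y. (cmod (f y))\<^sup>2)"
  by (rule integrable_const_bound[of _ K]) (use f_bound in auto)

private lemma expectation_levels:
  "(\<Sum>l<L. d * level d l * prob (A l)) = expectation (level_sum d L A)"
  "integrable \<mu> (level_sum d L A)"
  if "\<And>l. l < L \<Longrightarrow> A l \<in> sets \<mu>"
proof -
  have "integrable \<mu> (\<lambda>y. d * level d l * indicator (A l) y)" if "l < L" for l
    using that \<open>\<And>l. l < L \<Longrightarrow> A l \<in> sets \<mu>\<close>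
    by (intro integrable_mult_right integrable_real_indicator) (auto simp: less_top[symmetric])
  then show "integrable \<mu> (level_sum d L A)"
    and "(\<Sum>l<L. d * level d l * prob (A l)) = expectation (level_sum d L A)"
    unfolding level_sum_def[abs_def] using that by (auto intro!: Bochner_Integration.integrable_sum simp: Bochner_Integration.integral_sum simp del: sum_mult_indicator sum_indicator_mult integrable_mult_right_iff)
qed

private lemma sets_B: "l < L \<Longrightarrow> B l \<in> sets \<mu>" and sets_bd: "l < L \<Longrightarrow> bd l \<in> sets \<mu>"
  by measurable

private lemma bad_total:
  "expectation (level_sum d L bd) \<le> \<epsilon> * (level d L - d)"
proof -
  have "(\<Sum>l<L. d * level d l * prob (bd l)) \<le> (\<Sum>l<L. d * level d l * \<epsilon>)"
    using d level_pos[OF d(1)] bad by (intro sum_mono mult_left_mono) (auto simp: less_imp_le)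
  also have "\<dots> = \<epsilon> * (level d L - d)"
    by (simp add: sum_distrib_right[symmetric] sum_level)
  finally show ?thesis using expectation_levels(1)[of bd] sets_bd by simp
qed

text \<open>Layer-cake bound for \<open>(cmod (f y))\<^sup>2\<close> shrunk by
  \<open>(1 + d)\<^sup>2\<close>, whose superlevel sets are covered by those of \<open>g l\<close>
  and the bad sets. The measure is arbitrary, so the bound serves both the sampling measure and the
  empirical one.\<close>

lemma second_moment_le_levels:
  "expectation (\<lambda>y. (cmod (f y))\<^sup>2) \<le>
     (1 + d)\<^sup>2 * (d + (\<Sum>l<L. d * level d l * prob {y \<in> space \<mu>. level d l < (cmod (g l y))\<^sup>2})
                   + \<epsilon> * (level d L - d))"
proof -
  have pw: "(cmod (f y))\<^sup>2 / (1 + d)\<^sup>2 \<le>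
      d + level_sum d L B y + level_sum d L bd y"
    if y: "y \<in> space \<mu>" for y
  proof -
    \<comment> \<open>Shrinking keeps the value below the top level, as
      \<open>layer_cake_lower\<close> requires.\<close>
    have "(cmod (f y))\<^sup>2 / (1 + d)\<^sup>2 \<le> (cmod (f y))\<^sup>2 / 1"
      using d by (intro divide_left_mono) auto
    also have "\<dots> \<le> level d L" using f_bound[OF y] L by simp
    finally have "(cmod (f y))\<^sup>2 / (1 + d)\<^sup>2 - d \<le>
        (\<Sum>l<L. d * level d l * of_bool (level d l < (cmod (f y))\<^sup>2 / (1 + d)\<^sup>2))"
      by (rule layer_cake_lower[OF d(1)])
    also have "\<dots> \<le> (\<Sum>l<L. d * level d l * (indicator (B l) y + indicator (bd l) y))"
      using f_large[OF y] level_pos[OF d(1)] d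
      by (intro sum_mono mult_left_mono) (auto simp: less_imp_le split: split_indicator)
    finally show ?thesis by (simp only: distrib_left sum.distrib level_sum_def)
  qed
  have "expectation (\<lambda>y. (cmod (f y))\<^sup>2 / (1 + d)\<^sup>2) \<le>
     expectation (\<lambda>y. d + level_sum d L B y + level_sum d L bd y)"
    by (intro integral_mono pw Bochner_Integration.integrable_add integrable_const
          expectation_levels(2) sets_B sets_bd integrable_divide_zero integrable_f) auto
  also have "\<dots> = d + expectation (level_sum d L B)
       + expectation (level_sum d L bd)"
    using sets_B sets_bd
    by (simp add: prob_space Bochner_Integration.integral_add expectation_levels(2))
  also have "\<dots> \<le> d + (\<Sum>l<L. d * level d l * prob (B l)) + \<epsilon> * (level d L - d)"
    using bad_total expectation_levels(1)[of B] sets_B by simp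
  finally have "expectation (\<lambda>y. (cmod (f y))\<^sup>2) / (1 + d)\<^sup>2 \<le> d + (\<Sum>l<L. d * level d l * prob (B l)) + \<epsilon> * (level d L - d)"
    by simp
  then show ?thesis using d by (simp add: divide_le_eq mult.commute)
qed

text \<open>Roles exchanged: the superlevel sets of \<open>g l\<close> are covered by those of
  \<open>(cmod (f y))\<^sup>2 / (1 - d)\<^sup>2\<close> and the bad sets. The factor
  \<open>1 + d\<close> is the loss in \<open>layer_cake_upper\<close>.\<close>

lemma levels_le_second_moment:
  "(\<Sum>l<L. d * level d l * prob {y \<in> space \<mu>. level d l < (cmod (g l y))\<^sup>2}) \<le>
     (1 + d) / (1 - d)\<^sup>2 * expectation (\<lambda>y. (cmod (f y))\<^sup>2) + \<epsilon> * (level d L - d)"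
proof -
  have pw: "level_sum d L B y \<le>
      (1 + d) / (1 - d)\<^sup>2 * (cmod (f y))\<^sup>2 + level_sum d L bd y"
    if y: "y \<in> space \<mu>" for y
  proof -
    have "level_sum d L B y = (\<Sum>l<L. d * level d l * indicator (B l) y)"
      by (simp only: level_sum_def)
    also have "\<dots> \<le>
       (\<Sum>l<L. d * level d l * (of_bool (level d l < (cmod (f y))\<^sup>2 / (1 - d)\<^sup>2) + indicator (bd l) y))"
      using g_large[of y] level_pos[OF d(1)] d
      by (intro sum_mono mult_left_mono) (auto simp: less_imp_le split: split_indicator)
    also have "\<dots> = (\<Sum>l<L. d * level d l * of_bool (level d l < (cmod (f y))\<^sup>2 / (1 - d)\<^sup>2)) + level_sum d L bd y"
      by (simp only: distrib_left sum.distrib level_sum_def)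
    also have "(\<Sum>l<L. d * level d l * of_bool (level d l < (cmod (f y))\<^sup>2 / (1 - d)\<^sup>2)) \<le> (1 + d) * ((cmod (f y))\<^sup>2 / (1 - d)\<^sup>2)"
      by (rule layer_cake_upper) (use d in auto)
    finally show ?thesis by simp
  qed
  have "(\<Sum>l<L. d * level d l * prob (B l)) = expectation (level_sum d L B)"
    by (intro expectation_levels(1) sets_B)
  also have "\<dots> \<le> expectation (\<lambda>y. (1 + d) / (1 - d)\<^sup>2 * (cmod (f y))\<^sup>2 + level_sum d L bd y)"
    by (intro integral_mono pw Bochner_Integration.integrable_add
          expectation_levels(2) sets_B sets_bd integrable_mult_right integrable_f) auto
  also have "\<dots> = (1 + d) / (1 - d)\<^sup>2 * expectation (\<lambda>y. (cmod (f y))\<^sup>2) + expectation (level_sum d L bd)"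
    by (subst Bochner_Integration.integral_add)
       (auto intro!: integrable_mult_right integrable_f expectation_levels(2) sets_bd)
  also have "\<dots> \<le> (1 + d) / (1 - d)\<^sup>2 * expectation (\<lambda>y. (cmod (f y))\<^sup>2) + \<epsilon> * (level d L - d)"
    using bad_total by simp
  finally show ?thesis .
qed

end

section \<open>Collecting the constants\<close>

lemma near_isometry_numerics_upper:
  fixes d S S' \<kappa> E' :: real
  assumes d: "0 < d" "d < 1 / 13" and \<kappa>: "\<kappa> \<le> d / 9"
    and SE: "S \<le> (1 + d) / (1 - d)\<^sup>2 + \<kappa>" and S': "S' \<le> (1 + d) * S + d"
    and E': "E' \<le> (1 + d)\<^sup>2 * (d + S' + \<kappa>)"
  shows "E' < 1 + 13 * d"
proof -
  \<comment> \<open>Quadratic terms are turned back into linear ones throughout by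
    \<open>d < 1/13\<close>.\<close>
  have dd: "d\<^sup>2 \<le> d / 13" "d * d \<le> d / 13"
    using d mult_strict_left_mono[of d "1/13" d] by (simp_all add: power2_eq_square)
  have d3: "0 \<le> d ^ 3" using d by simp
  have "1 + d \<le> (1 + 7/2 * d) * (1 - d)\<^sup>2"
  proof -
    have "(1 + 7/2 * d) * (1 - d)\<^sup>2 = 1 + 3/2 * d - 6 * d\<^sup>2 + 7/2 * d ^ 3"
      by (simp add: power2_eq_square power3_eq_cube algebra_simps)
    then show ?thesis using dd d3 d by linarith
  qed
  then have "(1 + d) / (1 - d)\<^sup>2 \<le> 1 + 7/2 * d"
    using d by (simp add: divide_le_eq)
  \<comment> \<open>The constant 3.62 rounds up \<open>7/2 + 1/9\<close>.\<close>
  then have S: "S \<le> 1 + 362/100 * d" using SE \<kappa> d by linarith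
  have "(1 + d) * S \<le> (1 + d) * (1 + 362/100 * d)" using S d by (intro mult_left_mono) auto
  also have "\<dots> = 1 + 462/100 * d + 362/100 * (d * d)" by (simp add: field_simps)
  finally have "d + S' + \<kappa> \<le> 1 + 71/10 * d" using S' \<kappa> dd d by linarith
  then have "(1 + d)\<^sup>2 * (d + S' + \<kappa>) \<le> (1 + d)\<^sup>2 * (1 + 71/10 * d)" by (intro mult_left_mono) auto
  also have "\<dots> \<le> (1 + 21/10 * d) * (1 + 71/10 * d)"
    using d dd by (intro mult_right_mono) (auto simp: power2_eq_square algebra_simps)
  also have "\<dots> = 1 + 92/10 * d + 1491/100 * (d * d)" by (simp add: field_simps)
  \<comment> \<open>By \<open>d * d \<le> d / 13\<close> the left side is even below
    \<open>1 + 10.4 * d\<close>.\<close>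
  also have "\<dots> < 1 + 13 * d" using d dd by linarith
  finally show ?thesis using E' by linarith
qed

text \<open>Losses in units of \<open>d\<close>: 3.12 on passing to the levels under the first
  measure, 5.24 after the frequency error and the second bad sets, and 3 more for the factor
  \<open>(1 + d) / (1 - d)\<^sup>2\<close>; the total 8.24 stays below 13.\<close>

lemma near_isometry_numerics_lower:
  fixes d S S' \<kappa> E' :: real
  assumes d: "0 < d" "d < 1 / 13" and \<kappa>: "\<kappa> \<le> d / 9"
    and SE: "1 \<le> (1 + d)\<^sup>2 * (d + S + \<kappa>)" and S': "(1 - d) * S - d \<le> S'"
    and E': "S' \<le> (1 + d) / (1 - d)\<^sup>2 * E' + \<kappa>" "0 \<le> E'"
  shows "1 - 13 * d < E'"
proof -
  have dd: "0 < d * d" using d by simp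
  have "(1 - 2 * d) * (1 + d)\<^sup>2 = 1 - 3 * (d * d) - 2 * d * (d * d)"
    by (simp add: power2_eq_square algebra_simps)
  also have "\<dots> \<le> 1" using d dd mult_pos_pos[of d "d * d"] by linarith
  also have "\<dots> \<le> (d + S + \<kappa>) * (1 + d)\<^sup>2" using SE by (simp add: mult.commute)
  finally have "1 - 2 * d \<le> d + S + \<kappa>"
    using d by (simp add: mult_le_cancel_right)
  then have S: "1 - 312/100 * d \<le> S" using \<kappa> d by linarith
  have "(1 - d) * (1 - 312/100 * d) \<le> (1 - d) * S" using S d by (intro mult_left_mono) auto
  moreover have "(1 - d) * (1 - 312/100 * d) = 1 - 412/100 * d + 312/100 * (d * d)" by (simp add: field_simps)
  ultimately have "1 - 524/100 * d \<le> S' - \<kappa>" using S' \<kappa> d dd by linarith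
  also have "\<dots> \<le> (1 + d) / (1 - d)\<^sup>2 * E'" using E' by simp
  finally have *: "(1 - 524/100 * d) * (1 - d)\<^sup>2 \<le> (1 + d) * E'"
    using d by (simp add: le_divide_eq)
  have "(1 - 824/100 * d) * (1 + d) \<le> (1 - 524/100 * d) * (1 - d)\<^sup>2"
  proof -
    have "(1 - 524/100 * d) * (1 - d)\<^sup>2 = 1 - 724/100 * d + 1148/100 * (d * d) - 524/100 * d * (d * d)"
      by (simp add: power2_eq_square field_simps)
    moreover have "(1 - 824/100 * d) * (1 + d) = 1 - 724/100 * d - 824/100 * (d * d)"
      by (simp add: field_simps)
    moreover have "d * (d * d) \<le> 1 * (d * d)" using d by (intro mult_right_mono) auto
    ultimately show ?thesis using dd by linarith
  qed
  then have "(1 + d) * (1 - 824/100 * d) \<le> (1 + d) * E'" using * by (simp add: mult.commute)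
  then have "1 - 824/100 * d \<le> E'" using d by (simp add: mult_le_cancel_left)
  then show ?thesis using d by linarith
qed

text \<open>Three links in each direction: from the second moment 1 under \<open>\<mu>\<close> to
  the level sum \<open>S\<close>, by \<open>near\<close> to \<open>S'\<close>, and from there to the
  second moment under \<open>\<mu>'\<close>.\<close>

lemma second_moment_comparison:
  fixes f :: "'a \<Rightarrow> complex" and g :: "nat \<Rightarrow> 'a \<Rightarrow> complex"
  assumes \<mu>: "prob_space \<mu>" "prob_space \<mu>'" "sets \<mu>' = sets \<mu>" and d: "0 < d" "d < 1 / 13"
    and f_meas: "f \<in> borel_measurable \<mu>"
    and f_bound: "\<And>y. y \<in> space \<mu> \<Longrightarrow> (cmod (f y))\<^sup>2 \<le> K"
    and f_norm: "(LINT y|\<mu>. (cmod (f y))\<^sup>2) = 1"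
    and K: "0 < K" and L: "0 < L" "K \<le> level d L" "level d L \<le> (1 + d) * K"
    and g_meas: "\<And>l. l < L \<Longrightarrow> g l \<in> borel_measurable \<mu>"
    and bad: "\<And>l. l < L \<Longrightarrow>
      measure \<mu> {y \<in> space \<mu>. cmod (g l y - f y) > d * sqrt (level d l)} \<le> d / (10 * K)"
    and bad': "\<And>l. l < L \<Longrightarrow>
      measure \<mu>' {y \<in> space \<mu>. cmod (g l y - f y) > d * sqrt (level d l)} \<le> d / (10 * K)"
    and near: "\<And>l. l < L \<Longrightarrow>
      \<bar>measure \<mu>' {y \<in> space \<mu>. level d l < (cmod (g l y))\<^sup>2} - measure \<mu> {y \<in> space \<mu>. level d l < (cmod (g l y))\<^sup>2}\<bar>
      \<le> d * measure \<mu> {y \<in> space \<mu>. level d l < (cmod (g l y))\<^sup>2} + 1 / (real L * level d l)"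
  shows "1 - 13 * d < (LINT y|\<mu>'. (cmod (f y))\<^sup>2)" "(LINT y|\<mu>'. (cmod (f y))\<^sup>2) < 1 + 13 * d"
proof -
  have sp: "space \<mu>' = space \<mu>" using \<mu>(3) by (rule sets_eq_imp_space_eq)
  have meas: "measurable \<mu>' borel = (measurable \<mu> borel :: ('a \<Rightarrow> complex) set)"
    by (rule measurable_cong_sets) (use \<mu>(3) in auto)
  define B where "B l = {y \<in> space \<mu>. level d l < (cmod (g l y))\<^sup>2}" for l
  define S where "S = (\<Sum>l<L. d * level d l * measure \<mu> (B l))"
  define S' where "S' = (\<Sum>l<L. d * level d l * measure \<mu>' (B l))"
  \<comment> \<open>Bounds the weighted total of the bad sets; \<open>K\<close> cancels because the
    top level is at most \<open>(1 + d) * K\<close>.\<close>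
  define \<kappa> where "\<kappa> = d / (10 * K) * (level d L - d)"
  have "d / (10 * K) * (level d L - d) \<le> d / (10 * K) * ((1 + d) * K)"
    using L d K by (intro mult_left_mono) auto
  also have "\<dots> = d * (1 + d) / 10" using K by simp
  also have "\<dots> \<le> d / 9" using d mult_strict_left_mono[of d "1/13" d] by (simp add: algebra_simps)
  finally have \<kappa>: "\<kappa> \<le> d / 9" by (simp add: \<kappa>_def)
  \<comment> \<open>The weight \<open>d * level d l\<close> cancels the level in the additive error:
    each of the \<open>L\<close> levels costs \<open>d / L\<close>, in total
    \<open>d\<close>.\<close>
  have diff: "\<bar>S' - S\<bar> \<le> d * S + d"
  proof -
    have "\<bar>S' - S\<bar> = \<bar>\<Sum>l<L. d * level d l * (measure \<mu>' (B l) - measure \<mu> (B l))\<bar>"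
      by (simp add: S_def S'_def sum_subtractf right_diff_distrib)
    also have "\<dots> \<le> (\<Sum>l<L. \<bar>d * level d l * (measure \<mu>' (B l) - measure \<mu> (B l))\<bar>)"
      by (rule sum_abs)
    also have "\<dots> \<le> (\<Sum>l<L. d * level d l * (d * measure \<mu> (B l) + 1 / (real L * level d l)))"
    proof (intro sum_mono)
      fix l assume "l \<in> {..<L}"
      then have "d * level d l * \<bar>measure \<mu>' (B l) - measure \<mu> (B l)\<bar> \<le>
          d * level d l * (d * measure \<mu> (B l) + 1 / (real L * level d l))"
        unfolding B_def using d level_pos[OF d(1)] near by (intro mult_left_mono) (auto simp: less_imp_le)
      then show "\<bar>d * level d l * (measure \<mu>' (B l) - measure \<mu> (B l))\<bar> \<le>
          d * level d l * (d * measure \<mu> (B l) + 1 / (real L * level d l))"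
        using d level_pos[OF d(1), of l] by (simp add: abs_mult)
    qed
    also have "\<dots> = (\<Sum>l<L. d * (d * level d l * measure \<mu> (B l)) + d / real L)"
      using level_pos[OF d(1)] L by (intro sum.cong refl) (simp add: field_simps less_imp_neq[symmetric])
    also have "\<dots> = d * S + d"
      using L by (simp add: sum.distrib S_def sum_distrib_left)
    finally show ?thesis .
  qed
  note F = second_moment_le_levels[where \<epsilon> = "d / (10 * K)"] levels_le_second_moment[where \<epsilon> = "d / (10 * K)"]
  have d1: "d < 1" using d by simp
  have 1: "1 \<le> (1 + d)\<^sup>2 * (d + S + \<kappa>)"
    using F(1)[OF \<mu>(1) d(1) d1 f_meas f_bound L(2) g_meas bad] by (simp add: f_norm S_def B_def \<kappa>_def)
  have 2: "S \<le> (1 + d) / (1 - d)\<^sup>2 + \<kappa>"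
    using F(2)[OF \<mu>(1) d(1) d1 f_meas f_bound L(2) g_meas bad] by (simp add: f_norm S_def B_def \<kappa>_def)
  have f_meas': "f \<in> borel_measurable \<mu>'" and g_meas': "\<And>l. l < L \<Longrightarrow> g l \<in> borel_measurable \<mu>'"
    and f_bound': "\<And>y. y \<in> space \<mu>' \<Longrightarrow> (cmod (f y))\<^sup>2 \<le> K"
    using f_meas g_meas f_bound by (simp_all add: meas sp)
  note bad'' = bad'[folded sp]
  have 3: "(LINT y|\<mu>'. (cmod (f y))\<^sup>2) \<le> (1 + d)\<^sup>2 * (d + S' + \<kappa>)"
    using F(1)[OF \<mu>(2) d(1) d1 f_meas' f_bound' L(2) g_meas' bad''] by (simp add: S'_def B_def \<kappa>_def sp)
  have 4: "S' \<le> (1 + d) / (1 - d)\<^sup>2 * (LINT y|\<mu>'. (cmod (f y))\<^sup>2) + \<kappa>"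
    using F(2)[OF \<mu>(2) d(1) d1 f_meas' f_bound' L(2) g_meas' bad''] by (simp add: S'_def B_def \<kappa>_def sp)
  have S': "S' \<le> (1 + d) * S + d" "(1 - d) * S - d \<le> S'"
    using diff unfolding distrib_right left_diff_distrib by linarith+
  show "(LINT y|\<mu>'. (cmod (f y))\<^sup>2) < 1 + 13 * d"
    by (rule near_isometry_numerics_upper[OF d \<kappa> 2 S'(1) 3])
  show "1 - 13 * d < (LINT y|\<mu>'. (cmod (f y))\<^sup>2)"
    by (rule near_isometry_numerics_lower[OF d \<kappa> 1 S'(2) 4]) simp
qed

section \<open>Number of levels and sample sizes\<close>

text \<open>Stopping at the first level that reaches \<open>K\<close> keeps the overshoot within one
  factor \<open>1 + d\<close>; the count follows from logarithms and
  \<open>ln (1 + d) \<ge> 12 / 13 * d\<close>.\<close>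

lemma level_count:
  assumes d: "0 < d" "d < 1 / 13" and K: "1 \<le> K"
  obtains L where "0 < L" "K \<le> level d L" "level d L \<le> (1 + d) * K" "\<And>l. l < L \<Longrightarrow> level d l < K"
    "real L \<le> 2 * ln (K / d\<^sup>2) / d"
proof -
  define L where "L = (LEAST L. K \<le> level d L)"
  obtain n where "K / d < (1 + d) ^ n" using real_arch_pow[of "1 + d" "K / d"] d by auto
  then have "K \<le> level d n" using d by (simp add: level_def field_simps)
  then have L: "K \<le> level d L" unfolding L_def by (rule LeastI)
  have below: "level d l < K" if "l < L" for l using not_less_Least[of l "\<lambda>L. K \<le> level d L"] that by (auto simp: L_def)
  have "L \<noteq> 0" using L d K by (intro notI) simp
  then obtain l where l: "L = Suc l" by (cases L) auto
  have lK: "level d l < K" using below l by simp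
  have "(1 + d) ^ l < K / d" using lK d by (simp add: level_def field_simps)
  then have "ln ((1 + d) ^ l) < ln (K / d)" using d K by (subst ln_less_cancel_iff) auto
  then have "real l * ln (1 + d) < ln (K / d)" using d by (simp add: ln_realpow)
  moreover have R: "K / d \<le> K / d\<^sup>2"
    using d K by (intro divide_left_mono) (auto simp: power2_eq_square)
  moreover have "ln (K / d) \<le> ln (K / d\<^sup>2)"
    using d K by (intro ln_mono[OF R]) auto
  ultimately have "real l * ln (1 + d) \<le> ln (K / d\<^sup>2)"
    by linarith
  moreover have "real l * (12 / 13 * d) \<le> real l * ln (1 + d)"
  proof (intro mult_left_mono)
    have "12 / 13 * d \<le> d - d\<^sup>2" using d mult_strict_left_mono[of d "1/13" d] by (simp add: power2_eq_square)
    also have "\<dots> \<le> ln (1 + d)" using d by (intro ln_one_plus_pos_lower_bound) auto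
    finally show "12 / 13 * d \<le> ln (1 + d)" .
  qed simp
  moreover have "1 \<le> ln (K / d\<^sup>2)"
  proof -
    have "exp 1 \<le> (3::real)" by (rule exp_le)
    also have "\<dots> \<le> 1 / d" using d by (simp add: field_simps)
    also have "\<dots> \<le> K / d" using d K by (simp add: divide_right_mono)
    finally show ?thesis using R d K by (subst ln_ge_iff) auto
  qed
  \<comment> \<open>Here \<open>L = l + 1\<close>; the extra level is absorbed by
    \<open>ln (K / d\<^sup>2) \<ge> 1\<close>, at the price of the factor 2.\<close>
  ultimately have "real l * (12 / 13 * d) + 12 / 13 * d \<le> 2 * (12 / 13) * ln (K / d\<^sup>2)"
    using d by linarith
  then have "real L * d \<le> 2 * ln (K / d\<^sup>2)" by (simp add: l algebra_simps)
  then have "real L \<le> 2 * ln (K / d\<^sup>2) / d" using d by (simp add: le_divide_eq)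
  moreover have "level d L \<le> (1 + d) * K" using lK d by (simp add: l level_Suc)
  ultimately show thesis using that L below \<open>L \<noteq> 0\<close> by blast
qed

text \<open>Union bound in logarithmic form: against the Chernoff exponent
  \<open>m * d / (L * u)\<close>, the first term of the maximum pays for
  \<open>t * ln (4 * N)\<close> and the second for \<open>ln (2 * L / \<gamma>)\<close>. As
  \<open>t\<close> and the exponent are both of order \<open>1 / u\<close>, the condition on
  \<open>m\<close> is free of \<open>u\<close>.\<close>

lemma level_sample_size:
  fixes m N K d \<gamma> u :: real and L :: nat
  assumes d: "0 < d" "d < 1 / 13" and \<gamma>: "0 < \<gamma>" "\<gamma> < 1" and K: "1 \<le> K" and N: "1 \<le> N"
    and m: "m \<ge> 2 ^ 6 * exp 1 * (K / d\<^sup>2) * ln (K / d\<^sup>2) *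
           max (2 ^ 5 / d ^ 4 * ln (40 * (K / d\<^sup>2) * ln (K / d\<^sup>2)) * ln (4 * N))
               (1 / d * ln (1 / (\<gamma> * d) * ln (K / d\<^sup>2)))"
    and L: "0 < L" "real L \<le> 2 * ln (K / d\<^sup>2) / d" and u: "0 < u" "u < K"
  obtains t :: nat where "t > 0"
    "8 * exp (- (real t * (d * sqrt u)\<^sup>2 / (8 * (4 * K)))) \<le> d / (10 * K)"
    "(4 * N) ^ t * (2 * exp (- (m * d * (1 / (real L * u))))) < \<gamma> / real L"
proof -
  define R where "R = K / d\<^sup>2"
  define \<Lambda> where "\<Lambda> = ln R"
  define W where "W = ln (40 * R * \<Lambda>)"
  define X where "X = 2 ^ 5 / d ^ 4 * W * ln (4 * N)"
  define Y where "Y = 1 / d * ln (1 / (\<gamma> * d) * \<Lambda>)"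
  have m: "m \<ge> 2 ^ 6 * exp 1 * R * \<Lambda> * max X Y"
    using m by (simp only: R_def \<Lambda>_def W_def X_def Y_def)
  have d_inv: "3 \<le> 1 / d" "13 \<le> 1 / d" using d by (simp_all add: field_simps)
  have R: "K / d \<le> R" "0 < R"
    using d K by (auto simp: R_def power2_eq_square intro!: divide_left_mono)
  have "exp 1 \<le> (3::real)" by (rule exp_le)
  also have "\<dots> \<le> 1 / d" by (rule d_inv)
  also have "\<dots> \<le> K / d" using d K by (simp add: divide_right_mono)
  finally have \<Lambda>: "1 \<le> \<Lambda>" using R unfolding \<Lambda>_def by (subst ln_ge_iff) auto
  have L': "real L \<le> 2 * \<Lambda> / d" using L(2) by (simp only: \<Lambda>_def R_def)
  define W' where "W' = ln (80 * K / d)"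
  have Kd: "1 \<le> K / d" using d K by (simp add: field_simps)
  have W': "1 \<le> W'" "W' \<le> W"
  proof -
    have "exp 1 \<le> 80 * K / d" using \<open>exp 1 \<le> 3\<close> Kd by simp
    then show "1 \<le> W'" unfolding W'_def using d K by (subst ln_ge_iff) auto
    have "80 * K / d \<le> 40 * R * 1"
      using d K mult_right_mono[of 2 "1 / d" "K / d"] d_inv by (simp add: R_def power2_eq_square)
    also have "\<dots> \<le> 40 * R * \<Lambda>" using R \<Lambda> by (intro mult_left_mono) auto
    finally show "W' \<le> W" unfolding W'_def W_def using d K by (intro ln_mono) auto
  qed
  \<comment> \<open>With \<open>32 * R / u * W'\<close> draws the Hoeffding exponent is exactly
    \<open>W'\<close>, and \<open>8 * exp (- W')\<close> is the required
    \<open>d / (10 * K)\<close>; rounding up only helps.\<close>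
  define t where "t = nat \<lceil>32 * R / u * W'\<rceil>"
  have t_ge: "32 * R / u * W' \<le> real t" unfolding t_def by (rule real_nat_ceiling_ge)
  have pos: "0 < 32 * R / u * W'" using R u W' by simp
  then have "t > 0" using t_ge by (auto intro!: gr0I)
  have Ru: "1 \<le> R / u"
  proof -
    have "u \<le> K / d" using u Kd d K mult_left_mono[of 1 "1/d" K] d_inv by simp
    then show ?thesis using R u by simp
  qed
  \<comment> \<open>Rounding costs at most 1, hence at most one more \<open>(R / u) * W\<close>:
    this is why 32 becomes 33.\<close>
  have t_le: "real t \<le> 33 * (R / u) * W"
  proof -
    have "real t \<le> 32 * R / u * W' + 1"
      unfolding t_def using pos of_nat_ceiling[of "32 * R / u * W'"] by linarith
    also have "32 * R / u * W' \<le> 32 * (R / u) * W"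
      using W' Ru mult_left_mono[of W' W "32 * (R / u)"] by simp
    also have "1 \<le> (R / u) * W" using Ru W' mult_mono[of 1 "R / u" 1 W] by simp
    finally show ?thesis by simp
  qed
  have A: "8 * exp (- (real t * (d * sqrt u)\<^sup>2 / (8 * (4 * K)))) \<le> d / (10 * K)"
  proof -
    have "W' = 32 * R / u * W' * (d\<^sup>2 * u / (32 * K))"
      using d K u by (simp add: R_def)
    also have "\<dots> \<le> real t * (d\<^sup>2 * u / (32 * K))"
      using t_ge d K u by (intro mult_right_mono) auto
    also have "\<dots> = real t * (d * sqrt u)\<^sup>2 / (8 * (4 * K))"
      using u by (simp add: power_mult_distrib)
    finally have "exp (- (real t * (d * sqrt u)\<^sup>2 / (8 * (4 * K)))) \<le> exp (- W')" by simp
    also have "\<dots> = d / (80 * K)" using d K by (simp add: W'_def exp_minus)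
    finally show ?thesis by (simp add: field_simps)
  qed
  have lnN: "0 < ln (4 * N)" using N by simp
  have XY: "0 < X" "0 < Y"
  proof -
    show "0 < X" using d W' lnN by (simp add: X_def)
    have "1 < 1 / (\<gamma> * d) * \<Lambda>"
    proof -
      have "\<gamma> * d < 1 * 1" using \<gamma> d by (intro mult_strict_mono) auto
      then show ?thesis using \<gamma> d \<Lambda> by (simp add: field_simps)
    qed
    then show "0 < Y" using d by (simp add: Y_def)
  qed
  have B: "real t * ln (4 * N) + ln (2 * real L / \<gamma>) < m * d * (1 / (real L * u))"
  proof -
    have "real t * ln (4 * N) \<le> 33 * (R / u) * W * ln (4 * N)"
      using t_le lnN by (intro mult_right_mono) auto
    also have "\<dots> < 32 * (R * d\<^sup>2 / u) * X"
    proof -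
      have "32 * (R * d\<^sup>2 / u) * X = (1024 / d\<^sup>2) * ((R / u) * W * ln (4 * N))"
        using d u by (simp add: X_def field_simps power4_eq_xxxx power2_eq_square)
      moreover have "33 < 1024 / d\<^sup>2"
      proof -
        have "d\<^sup>2 \<le> 1" using d by (simp add: power_le_one)
        then show ?thesis using d by (simp add: field_simps)
      qed
      moreover have "0 < (R / u) * W * ln (4 * N)" using Ru W' lnN by (intro mult_pos_pos) auto
      ultimately have "33 * ((R / u) * W * ln (4 * N)) < 32 * (R * d\<^sup>2 / u) * X"
        by (simp only: mult_strict_right_mono)
      then show ?thesis by (simp add: mult.assoc)
    qed
    finally have 1: "real t * ln (4 * N) < 32 * (R * d\<^sup>2 / u) * X" .
    \<comment> \<open>The bound on the number of levels leaves a stray factor 4; it is at most the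
      remaining argument, so it no more than doubles the logarithm.\<close>
    have "ln (2 * real L / \<gamma>) \<le> ln (4 * (1 / (\<gamma> * d) * \<Lambda>))"
    proof (rule ln_mono)
      have "2 * real L / \<gamma> \<le> 2 * (2 * \<Lambda> / d) / \<gamma>"
        using L' \<gamma> by (intro divide_right_mono mult_left_mono) auto
      then show "2 * real L / \<gamma> \<le> 4 * (1 / (\<gamma> * d) * \<Lambda>)" by (simp add: field_simps)
    qed (use L \<gamma> in auto)
    also have "\<dots> \<le> 2 * ln (1 / (\<gamma> * d) * \<Lambda>)"
    proof -
      have "4 \<le> 1 / (\<gamma> * d) * \<Lambda>"
      proof -
        have "\<gamma> * d \<le> 1 * (1 / 4)" using \<gamma> d by (intro mult_mono) auto
        then show ?thesis using \<gamma> d \<Lambda> by (simp add: field_simps)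
      qed
      then have "ln 4 \<le> ln (1 / (\<gamma> * d) * \<Lambda>)" by (intro ln_mono) auto
      then show ?thesis using \<gamma> d \<Lambda> by (subst ln_mult) auto
    qed
    also have "\<dots> = 2 * d * Y" using d by (simp add: Y_def)
    also have "\<dots> \<le> 32 * (R * d\<^sup>2 / u) * Y"
    proof -
      have "1 \<le> R * d\<^sup>2 / u" using u d by (simp add: R_def)
      then show ?thesis using XY d by (intro mult_right_mono) auto
    qed
    finally have 2: "ln (2 * real L / \<gamma>) \<le> 32 * (R * d\<^sup>2 / u) * Y" .
    have "32 * (R * d\<^sup>2 / u) * X + 32 * (R * d\<^sup>2 / u) * Y \<le> 64 * (R * d\<^sup>2 / u) * max X Y"
    proof -
      have "32 * c * X + 32 * c * Y \<le> 64 * c * max X Y" if "0 \<le> c" for c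
        using mult_left_mono[of "X + Y" "2 * max X Y" "32 * c"] that by (simp add: algebra_simps)
      then show ?thesis by this (use R u in simp)
    qed
    \<comment> \<open>The level count \<open>2 * \<Lambda> / d\<close> cancels the
      \<open>\<Lambda>\<close> in the bound on \<open>m\<close>; what remains needs only
      \<open>exp 1 \<ge> 2\<close>.\<close>
    also have "\<dots> \<le> 2 ^ 6 * exp 1 * R * \<Lambda> * max X Y * (d / (2 * \<Lambda> / d * u))"
    proof -
      have "2 ^ 6 * exp 1 * R * \<Lambda> * max X Y * (d / (2 * \<Lambda> / d * u)) = exp 1 * (32 * (R * d\<^sup>2 / u) * max X Y)"
        using \<Lambda> d u by (simp add: field_simps power2_eq_square)
      moreover have "2 * (32 * (R * d\<^sup>2 / u) * max X Y) \<le> exp 1 * (32 * (R * d\<^sup>2 / u) * max X Y)"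
        using exp_ge_add_one_self[of 1] R u XY by (intro mult_right_mono) auto
      ultimately show ?thesis by simp
    qed
    also have "\<dots> \<le> m * (d / (real L * u))"
    proof (intro mult_mono m)
      show "d / (2 * \<Lambda> / d * u) \<le> d / (real L * u)"
        using L(1) L' d u \<Lambda> by (intro divide_left_mono mult_right_mono mult_pos_pos divide_pos_pos) auto
      have "0 \<le> 2 ^ 6 * exp 1 * R * \<Lambda> * max X Y" using R \<Lambda> XY by simp
      then show "0 \<le> m" using m by linarith
    qed (use \<Lambda> d u in auto)
    also have "\<dots> = m * d * (1 / (real L * u))" by simp
    finally show ?thesis using 1 2 by linarith
  qed
  have "(4 * N) ^ t * (2 * exp (- (m * d * (1 / (real L * u)))))
      = \<gamma> / real L * (exp (real t * ln (4 * N) + ln (2 * real L / \<gamma>)) * exp (- (m * d * (1 / (real L * u)))))"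
    using L \<gamma> N by (simp add: exp_add exp_of_nat_mult)
  also have "\<dots> < \<gamma> / real L * 1"
    unfolding exp_add[symmetric]
    by (rule mult_strict_left_mono) (use B L \<gamma> in auto)
  finally show thesis using that[OF \<open>t > 0\<close> A] by simp
qed

section \<open>The restricted isometry property for systems bounded everywhere\<close>

text \<open>\<open>\<rho>'\<close> is the empirical measure of the points, encoded as the image of
  the uniform distribution on the index type. It carries the sigma-algebra of \<open>\<rho>\<close>,
  so the approximation and slicing lemmas apply to the pair.\<close>

lemma
  fixes x :: "'m::finite \<Rightarrow> 'a"
  assumes "prob_space \<rho>" and x: "\<And>i. x i \<in> space \<rho>"
  defines "\<rho>' \<equiv> distr (measure_pmf (pmf_of_set UNIV)) \<rho> x"
  shows prob_space_empirical: "prob_space \<rho>'"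
    and sets_empirical: "sets \<rho>' = sets \<rho>"
    and measure_empirical: "B \<in> sets \<rho> \<Longrightarrow> measure \<rho>' B = (\<Sum>i\<in>UNIV. indicator B (x i)) / real CARD('m)"
    and integral_empirical: "F \<in> borel_measurable \<rho> \<Longrightarrow>
           (LINT y|\<rho>'. F y) = (\<Sum>i\<in>UNIV. F (x i) :: real) / real CARD('m)"
proof -
  have meas: "x \<in> measure_pmf (pmf_of_set UNIV) \<rightarrow>\<^sub>M \<rho>" using x by simp
  show "prob_space \<rho>'" unfolding \<rho>'_def by (rule measure_pmf.prob_space_distr[OF meas])
  show sets: "sets \<rho>' = sets \<rho>" by (simp add: \<rho>'_def)
  show int: "(LINT y|\<rho>'. F y) = (\<Sum>i\<in>UNIV. F (x i)) / real CARD('m)" if "F \<in> borel_measurable \<rho>" for F :: "'a \<Rightarrow> real"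
    unfolding \<rho>'_def by (subst integral_distr[OF meas that]) (simp add: integral_pmf_of_set)
  show "measure \<rho>' B = (\<Sum>i\<in>UNIV. indicator B (x i)) / real CARD('m)" if "B \<in> sets \<rho>"
    using int[of "indicator B"] that sets sets.sets_into_space[of B \<rho>'] by (simp add: Int_absorb2)
qed

text \<open>Parseval's identity, computed over the complex numbers so that the squared modulus
  expands into a double sum; boundedness makes the products integrable.\<close>

lemma second_moment_orthonormal:
  fixes \<phi> :: "'n::finite \<Rightarrow> 'a \<Rightarrow> complex" and z :: "'n \<Rightarrow> complex"
  assumes "prob_space \<rho>" and meas: "\<And>j. \<phi> j \<in> borel_measurable \<rho>"
    and bound: "\<And>j y. y \<in> space \<rho> \<Longrightarrow> cmod (\<phi> j y) \<le> \<Theta>"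
    and orth: "\<And>j k. (LINT y|\<rho>. \<phi> j y * cnj (\<phi> k y)) = (if j = k then 1 else 0)"
  shows "(LINT y|\<rho>. (cmod (\<Sum>j\<in>UNIV. z j * \<phi> j y))\<^sup>2) = (\<Sum>j\<in>UNIV. (cmod (z j))\<^sup>2)"
proof -
  interpret prob_space \<rho> by fact
  note meas[measurable]
  have [measurable]: "cnj \<in> borel_measurable borel"
    by (intro borel_measurable_continuous_onI continuous_intros)
  have int: "integrable \<rho> (\<lambda>y. \<phi> j y * cnj (\<phi> k y))" for j k
  proof (rule integrable_const_bound[of _ "\<Theta> * \<Theta>"])
    show "AE y in \<rho>. cmod (\<phi> j y * cnj (\<phi> k y)) \<le> \<Theta> * \<Theta>"
    proof (rule AE_I2)
      fix y assume y: "y \<in> space \<rho>"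
      have "0 \<le> \<Theta>" using bound[OF y, of j] norm_ge_zero order_trans by blast
      then show "cmod (\<phi> j y * cnj (\<phi> k y)) \<le> \<Theta> * \<Theta>"
        using bound[OF y] by (auto simp: norm_mult intro!: mult_mono)
    qed
  qed measurable
  have "complex_of_real (LINT y|\<rho>. (cmod (\<Sum>j\<in>UNIV. z j * \<phi> j y))\<^sup>2)
      = (LINT y|\<rho>. complex_of_real ((cmod (\<Sum>j\<in>UNIV. z j * \<phi> j y))\<^sup>2))"
    by (rule integral_complex_of_real[symmetric])
  also have "\<dots> = (LINT y|\<rho>. (\<Sum>j\<in>UNIV. \<Sum>k\<in>UNIV. (z j * cnj (z k)) * (\<phi> j y * cnj (\<phi> k y))))"
    by (intro Bochner_Integration.integral_cong refl)
       (simp only: complex_norm_square cnj_sum sum_product complex_cnj_mult, simp only: mult_ac)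
  also have "\<dots> = (\<Sum>j\<in>UNIV. \<Sum>k\<in>UNIV. (z j * cnj (z k)) * (if j = k then 1 else 0))"
    using int by (simp only: Bochner_Integration.integral_sum Bochner_Integration.integrable_sum
        integrable_mult_right integral_mult_right_zero orth)
  also have "\<dots> = (\<Sum>j\<in>UNIV. z j * cnj (z j))"
    by (simp add: if_distrib[of "(*) _"] cong: if_cong)
  also have "\<dots> = complex_of_real (\<Sum>j\<in>UNIV. (cmod (z j))\<^sup>2)" by (simp only: of_real_sum complex_norm_square)
  finally show ?thesis by (simp only: of_real_eq_iff)
qed

text \<open>Cauchy-Schwarz on the support.\<close>

lemma sparse_l1_bound:
  fixes z :: "'n::finite \<Rightarrow> complex"
  assumes z: "(\<Sum>j\<in>UNIV. (cmod (z j))\<^sup>2) = 1" and s: "card {j. z j \<noteq> 0} \<le> s"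
  shows "(\<Sum>j\<in>UNIV. cmod (z j)) \<le> sqrt (real s)"
proof -
  have eq: "(\<Sum>j\<in>UNIV. cmod (z j)) = (\<Sum>j | z j \<noteq> 0. cmod (z j))"
    by (intro sum.mono_neutral_right) auto
  have "(\<Sum>j | z j \<noteq> 0. cmod (z j))\<^sup>2 \<le> (\<Sum>j | z j \<noteq> 0. (cmod (z j))\<^sup>2) * (\<Sum>j | z j \<noteq> 0. 1\<^sup>2)"
    using Cauchy_Schwarz_ineq_sum[of "\<lambda>j. cmod (z j)" "\<lambda>_. 1" "{j. z j \<noteq> 0}"] by simp
  also have "\<dots> \<le> 1 * real s"
    using s z by (intro mult_mono) (auto simp: sum_nonneg intro!: order_trans[OF sum_mono2 eq_refl[OF z]])
  finally show ?thesis unfolding eq by (intro real_le_rsqrt) simp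
qed

lemma sparse_sup_bound:
  fixes z :: "'n::finite \<Rightarrow> complex"
  assumes z: "(\<Sum>j\<in>UNIV. cmod (z j)) \<le> sqrt (real s)" and a: "\<And>j. cmod (a j) \<le> \<Theta>"
  shows "(cmod (\<Sum>j\<in>UNIV. z j * a j))\<^sup>2 \<le> \<Theta>\<^sup>2 * real s"
proof -
  have \<Theta>: "0 \<le> \<Theta>" using a norm_ge_zero order_trans by blast
  have "cmod (\<Sum>j\<in>UNIV. z j * a j) \<le> (\<Sum>j\<in>UNIV. cmod (z j) * \<Theta>)"
    using a by (intro sum_norm_le) (auto simp: norm_mult intro!: mult_left_mono)
  also have "\<dots> \<le> sqrt (real s) * \<Theta>"
    unfolding sum_distrib_right[symmetric] using z \<Theta> by (rule mult_right_mono)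
  finally have "(cmod (\<Sum>j\<in>UNIV. z j * a j))\<^sup>2 \<le> (sqrt (real s) * \<Theta>)\<^sup>2" by (intro power_mono) auto
  then show ?thesis by (simp add: power_mult_distrib mult.commute)
qed

text \<open>The exceptional event is a union over finitely many levels and sample lists and is fixed
  before \<open>z\<close>; outside it the estimate holds for all sparse unit vectors at
  once.\<close>

lemma (in prob_space) restricted_isometry_bounded:
  fixes \<phi> :: "'n::finite \<Rightarrow> 'b \<Rightarrow> complex" and y :: "'m::finite \<Rightarrow> 'a \<Rightarrow> 'b"
  assumes indep: "indep_vars (\<lambda>_. \<rho>) y UNIV"
    and distr: "\<And>i. distr M \<rho> (y i) = \<rho>"
    and meas: "\<And>j. \<phi> j \<in> borel_measurable \<rho>"
    and bound: "\<And>j x. x \<in> space \<rho> \<Longrightarrow> cmod (\<phi> j x) \<le> \<Theta>" and \<Theta>: "1 \<le> \<Theta>"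
    and orth: "\<And>j k. (LINT x|\<rho>. \<phi> j x * cnj (\<phi> k x)) = (if j = k then 1 else 0)"
    and d: "0 < d" "d < 1 / 13" and \<gamma>: "0 < \<gamma>" "\<gamma> < 1" and s: "1 \<le> s"
    and m: "real CARD('m) \<ge> 2 ^ 6 * exp 1 * (\<Theta>\<^sup>2 * real s / d\<^sup>2) * ln (\<Theta>\<^sup>2 * real s / d\<^sup>2) *
           max (2 ^ 5 / d ^ 4 * ln (40 * (\<Theta>\<^sup>2 * real s / d\<^sup>2) * ln (\<Theta>\<^sup>2 * real s / d\<^sup>2)) * ln (4 * real CARD('n)))
               (1 / d * ln (1 / (\<gamma> * d) * ln (\<Theta>\<^sup>2 * real s / d\<^sup>2)))"
  obtains G where "G \<in> events" "prob G > 1 - \<gamma>"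
    "\<And>\<omega> z. \<omega> \<in> G \<Longrightarrow> (\<Sum>j\<in>UNIV. (cmod (z j))\<^sup>2) = 1 \<Longrightarrow> card {j. z j \<noteq> 0} \<le> s \<Longrightarrow>
       1 - 13 * d < (\<Sum>i\<in>UNIV. (cmod (\<Sum>j\<in>UNIV. z j * \<phi> j (y i \<omega>)))\<^sup>2) / real CARD('m) \<and>
       (\<Sum>i\<in>UNIV. (cmod (\<Sum>j\<in>UNIV. z j * \<phi> j (y i \<omega>)))\<^sup>2) / real CARD('m) < 1 + 13 * d"
proof -
  have y[measurable]: "y i \<in> M \<rightarrow>\<^sub>M \<rho>" for i
    using indep by (auto simp: indep_vars_def)
  note meas[measurable]
  interpret \<rho>: prob_space \<rho>
    using prob_space_distr[OF y[of undefined]] by (simp add: distr)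
  define K where "K = \<Theta>\<^sup>2 * real s"
  have K: "1 \<le> K" using \<Theta> s mult_mono[of 1 "\<Theta>\<^sup>2" 1 "real s"] by (simp add: K_def)
  note m = m[folded K_def]
  obtain L where L: "0 < L" "K \<le> level d L" "level d L \<le> (1 + d) * K" "\<And>l. l < L \<Longrightarrow> level d l < K"
    "real L \<le> 2 * ln (K / d\<^sup>2) / d"
    using level_count[OF d K] by blast
  have "\<exists>t. 0 < t \<and> 8 * exp (- (real t * (d * sqrt (level d l))\<^sup>2 / (8 * (4 * K)))) \<le> d / (10 * K) \<and>
     (4 * real CARD('n)) ^ t * (2 * exp (- (real CARD('m) * d * (1 / (real L * level d l))))) < \<gamma> / real L"
    if "l < L" for l
    using level_sample_size[OF d \<gamma> K _ m L(1,5) level_pos[OF d(1)] L(4)[OF that]] by (metis One_nat_def Suc_leI of_nat_1 of_nat_mono zero_less_card_finite)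
  then obtain t where t: "\<And>l. l < L \<Longrightarrow> 0 < t l"
    "\<And>l. l < L \<Longrightarrow> 8 * exp (- (real (t l) * (d * sqrt (level d l))\<^sup>2 / (8 * (4 * K)))) \<le> d / (10 * K)"
    "\<And>l. l < L \<Longrightarrow> (4 * real CARD('n)) ^ t l * (2 * exp (- (real CARD('m) * d * (1 / (real L * level d l))))) < \<gamma> / real L"
    by metis
  define g where "g l = vertex_mean (sqrt (real s)) \<phi> (t l)" for l
  have g_meas[measurable]: "g l v \<in> borel_measurable \<rho>" for l v
    unfolding g_def using meas by (rule borel_measurable_vertex_mean)
  define B where "B l v = {x \<in> space \<rho>. level d l < (cmod (g l v x))\<^sup>2}" for l v
  have B[measurable]: "B l v \<in> sets \<rho>" for l v unfolding B_def by measurable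
  define E where "E l v = {\<omega> \<in> space M. \<bar>(\<Sum>i\<in>UNIV. indicator (B l v) (y i \<omega>)) / real CARD('m) - measure \<rho> (B l v)\<bar> >
            d * measure \<rho> (B l v) + 1 / (real L * level d l)}" for l v
  have E[measurable]: "E l v \<in> events" for l v unfolding E_def by measurable
  define Bad where "Bad = (\<Union>l<L. \<Union>v\<in>samples (t l). E l v)"
  have Bad[measurable]: "Bad \<in> events"
    unfolding Bad_def by (intro sets.finite_UN) auto
  have "prob Bad \<le> (\<Sum>l<L. prob (\<Union>v\<in>samples (t l). E l v))"
    unfolding Bad_def by (intro finite_measure_subadditive_finite) (auto intro!: sets.finite_UN)
  also have "\<dots> < (\<Sum>l<L. \<gamma> / real L)"
  proof (intro sum_strict_mono)
    fix l assume l: "l \<in> {..<L}"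
    have "prob (\<Union>v\<in>samples (t l). E l v) \<le> (\<Sum>v\<in>samples (t l). prob (E l v))"
      by (intro finite_measure_subadditive_finite) auto
    also have "\<dots> \<le> (\<Sum>v\<in>(samples (t l) :: (nat \<Rightarrow> 'n \<times> complex) set). 2 * exp (- (real CARD('m) * d * (1 / (real L * level d l)))))"
      unfolding E_def using d by (intro sum_mono Chernoff_frequency[OF indep distr B]) auto
    also have "\<dots> = (4 * real CARD('n)) ^ t l * (2 * exp (- (real CARD('m) * d * (1 / (real L * level d l)))))"
      by (simp add: card_samples)
    also have "\<dots> < \<gamma> / real L" using t(3) l by simp
    finally show "prob (\<Union>v\<in>samples (t l). E l v) < \<gamma> / real L" .
  qed (use L in auto)
  also have "\<dots> = \<gamma>" using L by simp
  finally have G: "prob (space M - Bad) > 1 - \<gamma>" by (simp add: prob_compl)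
  have rip: "1 - 13 * d < (\<Sum>i\<in>UNIV. (cmod (\<Sum>j\<in>UNIV. z j * \<phi> j (y i \<omega>)))\<^sup>2) / real CARD('m) \<and>
       (\<Sum>i\<in>UNIV. (cmod (\<Sum>j\<in>UNIV. z j * \<phi> j (y i \<omega>)))\<^sup>2) / real CARD('m) < 1 + 13 * d"
    if \<omega>: "\<omega> \<in> space M - Bad" and z: "(\<Sum>j\<in>UNIV. (cmod (z j))\<^sup>2) = 1" "card {j. z j \<noteq> 0} \<le> s" for \<omega> z
  proof -
    define x where "x i = y i \<omega>" for i
    have x: "x i \<in> space \<rho>" for i
      using measurable_space[OF y] \<omega> by (simp add: x_def)
    \<comment> \<open>With the empirical measure as the second measure, the approximants depend on
      \<open>\<omega>\<close> as well as on \<open>z\<close>. This is harmless: they come from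
      \<open>samples (t l)\<close>, and \<open>Bad\<close> covers all of its members.\<close>
    define \<rho>' where "\<rho>' = distr (measure_pmf (pmf_of_set UNIV)) \<rho> x"
    note emp = prob_space_empirical[where x = x, OF \<rho>.prob_space_axioms x, folded \<rho>'_def]
      sets_empirical[where x = x, OF \<rho>.prob_space_axioms x, folded \<rho>'_def]
      measure_empirical[where x = x, OF \<rho>.prob_space_axioms x, folded \<rho>'_def]
      integral_empirical[where x = x, OF \<rho>.prob_space_axioms x, folded \<rho>'_def]
    define f where "f u = (\<Sum>j\<in>UNIV. z j * \<phi> j u)" for u
    have f[measurable]: "f \<in> borel_measurable \<rho>" unfolding f_def by measurable
    note l1 = sparse_l1_bound[OF z]
    have "\<exists>v\<in>samples (t l). measure \<rho> {u \<in> space \<rho>. cmod (g l v u - f u) > d * sqrt (level d l)} \<le> d / (10 * K) \<and>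
        measure \<rho>' {u \<in> space \<rho>. cmod (g l v u - f u) > d * sqrt (level d l)} \<le> d / (10 * K)" if l: "l < L" for l
    proof -
      have "(sqrt (real s))\<^sup>2 * \<Theta>\<^sup>2 = K" by (simp add: K_def mult.commute)
      then obtain v where "v \<in> samples (t l)"
        "measure \<rho> {u \<in> space \<rho>. cmod (g l v u - f u) > d * sqrt (level d l)}
           \<le> 8 * exp (- (real (t l) * (d * sqrt (level d l))\<^sup>2 / (8 * (4 * K))))"
        "measure \<rho>' {u \<in> space \<rho>. cmod (g l v u - f u) > d * sqrt (level d l)}
           \<le> 8 * exp (- (real (t l) * (d * sqrt (level d l))\<^sup>2 / (8 * (4 * K))))"
        using sparse_approximation[where \<phi> = \<phi> and z = z and t = "t l" and \<Theta> = \<Theta>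
            and c = "sqrt (real s)" and \<tau> = "d * sqrt (level d l)",
            OF \<rho>.prob_space_axioms emp(1,2) meas bound _ _ l1 t(1)[OF l], folded f_def g_def]
          \<Theta> s d level_pos[OF d(1), of l]
        by (auto simp: less_imp_le)
      with t(2)[OF l] show ?thesis by (meson order_trans)
    qed
    then have "\<forall>l\<in>{..<L}. \<exists>v. v \<in> samples (t l) \<and>
        measure \<rho> {u \<in> space \<rho>. cmod (g l v u - f u) > d * sqrt (level d l)} \<le> d / (10 * K) \<and>
        measure \<rho>' {u \<in> space \<rho>. cmod (g l v u - f u) > d * sqrt (level d l)} \<le> d / (10 * K)"
      by blast
    from bchoice[OF this] obtain v where v: "\<And>l. l < L \<Longrightarrow> v l \<in> samples (t l)"
      "\<And>l. l < L \<Longrightarrow> measure \<rho> {u \<in> space \<rho>. cmod (g l (v l) u - f u) > d * sqrt (level d l)} \<le> d / (10 * K)"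
      "\<And>l. l < L \<Longrightarrow> measure \<rho>' {u \<in> space \<rho>. cmod (g l (v l) u - f u) > d * sqrt (level d l)} \<le> d / (10 * K)"
      by auto
    have near: "\<bar>measure \<rho>' (B l (v l)) - measure \<rho> (B l (v l))\<bar>
      \<le> d * measure \<rho> (B l (v l)) + 1 / (real L * level d l)" if "l < L" for l
    proof -
      have "\<omega> \<notin> E l (v l)" using \<omega> v(1)[OF that] that by (auto simp: Bad_def)
      then show ?thesis using \<omega> by (simp add: E_def emp(3)[OF B] x_def not_less)
    qed
    have f_bound: "(cmod (f u))\<^sup>2 \<le> K" if "u \<in> space \<rho>" for u
      unfolding f_def K_def using bound[OF that] by (intro sparse_sup_bound[OF l1])
    have f_norm: "(LINT u|\<rho>. (cmod (f u))\<^sup>2) = 1"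
      unfolding f_def z(1)[symmetric] by (rule second_moment_orthonormal[OF \<rho>.prob_space_axioms meas bound orth])
    have K0: "0 < K" using K by simp
    note cmp = second_moment_comparison[OF \<rho>.prob_space_axioms emp(1,2) d f f_bound f_norm K0 L(1-3) g_meas v(2,3) near[unfolded B_def]]
    have "(LINT u|\<rho>'. (cmod (f u))\<^sup>2) = (\<Sum>i\<in>UNIV. (cmod (f (x i)))\<^sup>2) / real CARD('m)"
      by (rule emp(4)) measurable
    with cmp show ?thesis by (simp add: f_def x_def)
  qed
  show thesis
    by (rule that[OF _ G rip]) auto
qed

section \<open>Almost everywhere bounded systems\<close>

lemma compact_sparse_sphere:
  "compact {z :: complex ^ 'n::finite. norm z = 1 \<and> card (vec_supp z) \<le> s}"
proof -
  \<comment> \<open>Sparse vectors form a finite union of coordinate subspaces, one for each index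
    set of size at most \<open>s\<close>, hence a closed set.\<close>
  have "{z :: complex ^ 'n. norm z = 1 \<and> card (vec_supp z) \<le> s} =
      sphere 0 1 \<inter> (\<Union>S\<in>{S. card S \<le> s}. {z. \<forall>j\<in>- S. z $ j = 0})"
  proof (intro subset_antisym subsetI)
    fix z :: "complex ^ 'n"
    assume "z \<in> {z. norm z = 1 \<and> card (vec_supp z) \<le> s}"
    then show "z \<in> sphere 0 1 \<inter> (\<Union>S\<in>{S. card S \<le> s}. {z. \<forall>j\<in>- S. z $ j = 0})"
      by (auto intro!: exI[of _ "vec_supp z"] simp: vec_supp_def)
  next
    fix z :: "complex ^ 'n"
    assume z: "z \<in> sphere 0 1 \<inter> (\<Union>S\<in>{S. card S \<le> s}. {z. \<forall>j\<in>- S. z $ j = 0})"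
    then obtain S where S: "card S \<le> s" "\<forall>j\<in>- S. z $ j = 0" by auto
    then have "vec_supp z \<subseteq> S" by (auto simp: vec_supp_def)
    then have "card (vec_supp z) \<le> s" using S card_mono[of S "vec_supp z"] by simp
    with z show "z \<in> {z. norm z = 1 \<and> card (vec_supp z) \<le> s}" by simp
  qed
  moreover have "closed (\<Union>S\<in>{S. card S \<le> s}. {z :: complex ^ 'n. \<forall>j\<in>- S. z $ j = 0})"
    by (simp only: Collect_ball_eq) (intro closed_UN closed_INT ballI closed_Collect_eq continuous_intros; simp)
  ultimately show ?thesis by (simp add: compact_Int_closed)
qed

lemma vec_supp_scaleR: "c \<noteq> 0 \<Longrightarrow> vec_supp (c *\<^sub>R z) = vec_supp z"
  by (simp add: vec_supp_def)

lemma matrix_vector_scaleR: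
  fixes A :: "complex ^ 'n ^ 'm"
  shows "A *v (c *\<^sub>R z) = c *\<^sub>R (A *v z)"
  by (simp add: matrix_vector_mult_def vec_eq_iff scaleR_sum_right)

lemma sparse_homogeneous:
  fixes A :: "complex ^ 'n ^ 'm"
  assumes unit: "\<And>z. norm z = 1 \<Longrightarrow> card (vec_supp z) \<le> s \<Longrightarrow>
      lo < (norm (A *v z))\<^sup>2 \<and> (norm (A *v z))\<^sup>2 < hi"
    and z: "z \<noteq> 0" "card (vec_supp z) \<le> s"
  shows "lo * (norm z)\<^sup>2 < (norm (A *v z))\<^sup>2 \<and> (norm (A *v z))\<^sup>2 < hi * (norm z)\<^sup>2"
proof -
  have n: "0 < (norm z)\<^sup>2" using z by simp
  have "lo < (norm (A *v ((1 / norm z) *\<^sub>R z)))\<^sup>2 \<and> (norm (A *v ((1 / norm z) *\<^sub>R z)))\<^sup>2 < hi"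
    using z by (intro unit) (auto simp: vec_supp_scaleR)
  then have "lo < (norm (A *v z))\<^sup>2 / (norm z)\<^sup>2 \<and> (norm (A *v z))\<^sup>2 / (norm z)\<^sup>2 < hi"
    by (simp add: matrix_vector_scaleR power_divide)
  then show ?thesis using n by (simp add: less_divide_eq divide_less_eq)
qed

text \<open>Openness yields the measurability of the event in the theorem, a condition on uncountably many \<open>z\<close>.\<close>

lemma open_sparse_isometry:
  "open {A :: complex ^ 'n ^ 'm. \<forall>z. z \<noteq> 0 \<and> card (vec_supp z) \<le> s \<longrightarrow>
      lo * (norm z)\<^sup>2 < (norm (A *v z))\<^sup>2 \<and> (norm (A *v z))\<^sup>2 < hi * (norm z)\<^sup>2}" (is "open ?T")
proof -
  define S where "S = {z :: complex ^ 'n. norm z = 1 \<and> card (vec_supp z) \<le> s}"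
  define W where "W = {x :: (complex ^ 'n ^ 'm) \<times> (complex ^ 'n).
      lo < (norm (fst x *v snd x))\<^sup>2 \<and> (norm (fst x *v snd x))\<^sup>2 < hi}"
  have "continuous_on UNIV (\<lambda>x :: (complex ^ 'n ^ 'm) \<times> (complex ^ 'n). fst x *v snd x)"
    unfolding matrix_vector_mult_def by (intro continuous_intros)
  then have W: "open W"
    unfolding W_def by (intro open_Collect_conj open_Collect_less continuous_intros)
  have S: "compact S" unfolding S_def by (rule compact_sparse_sphere)
  \<comment> \<open>By homogeneity only the compact set \<open>S\<close> has to be tested, which
    brings the tube lemma into play.\<close>
  have T: "?T = {A. {A} \<times> S \<subseteq> W}"
  proof (intro subset_antisym subsetI)
    fix A assume A: "A \<in> ?T"
    have "lo < (norm (A *v z))\<^sup>2 \<and> (norm (A *v z))\<^sup>2 < hi" if "z \<in> S" for z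
    proof -
      have "z \<noteq> 0" "norm z = 1" "card (vec_supp z) \<le> s" using that by (auto simp: S_def)
      then show ?thesis using A by (auto dest!: spec[of _ z])
    qed
    then show "A \<in> {A. {A} \<times> S \<subseteq> W}" by (auto simp: W_def)
  next
    fix A assume "A \<in> {A. {A} \<times> S \<subseteq> W}"
    then have "lo < (norm (A *v z))\<^sup>2 \<and> (norm (A *v z))\<^sup>2 < hi" if "norm z = 1" "card (vec_supp z) \<le> s" for z
      using that by (auto simp: W_def S_def)
    then show "A \<in> ?T" using sparse_homogeneous[of s lo A hi] by blast
  qed
  show ?thesis
  proof (subst open_subopen, intro ballI)
    fix A assume "A \<in> ?T"
    then have "{A} \<times> S \<subseteq> W" using T by blast
    from Elementary_Topology.tube_lemma[OF S W this]
    obtain X where "A \<in> X" "open X" "X \<times> S \<subseteq> W" by blast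
    then show "\<exists>X. open X \<and> A \<in> X \<and> X \<subseteq> ?T" unfolding T by blast
  qed
qed

lemma borel_measurable_matrix:
  fixes a :: "'w \<Rightarrow> 'm::finite \<Rightarrow> 'n::finite \<Rightarrow> complex"
  assumes "\<And>i j. (\<lambda>\<omega>. a \<omega> i j) \<in> borel_measurable M"
  shows "(\<lambda>\<omega>. \<chi> i j. a \<omega> i j) \<in> borel_measurable M"
proof (subst borel_measurable_euclidean_space, intro ballI)
  fix b :: "complex ^ 'n ^ 'm" assume "b \<in> Basis"
  then obtain i j c where b: "b = axis i (axis j c)" by (auto simp: Basis_vec_def)
  have "(\<lambda>\<omega>. a \<omega> i j \<bullet> c) \<in> borel_measurable M"
    using assms by (intro borel_measurable_inner) auto
  then show "(\<lambda>\<omega>. (\<chi> i j. a \<omega> i j) \<bullet> b) \<in> borel_measurable M"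
    by (simp add: b inner_axis)
qed

text \<open>Connects the matrix with the empirical second moment that
  \<open>restricted_isometry_bounded\<close> controls.\<close>

lemma norm_sampling_matrix:
  fixes y :: "'m::finite \<Rightarrow> 'a"
  shows "(norm (sampling_matrix \<Psi> \<nu> y *v z))\<^sup>2 =
     (\<Sum>i\<in>UNIV. (cmod (\<Sum>j\<in>UNIV. z $ j * \<Psi> (\<nu> j) (y i)))\<^sup>2) / real CARD('m)"
proof -
  have "(sampling_matrix \<Psi> \<nu> y *v z) $ i =
      (\<Sum>j\<in>UNIV. z $ j * \<Psi> (\<nu> j) (y i)) / complex_of_real (sqrt (real CARD('m)))" for i
    by (simp add: sampling_matrix_def matrix_vector_mult_def sum_divide_distrib mult.commute)
  then have "(cmod ((sampling_matrix \<Psi> \<nu> y *v z) $ i))\<^sup>2 =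
      (cmod (\<Sum>j\<in>UNIV. z $ j * \<Psi> (\<nu> j) (y i)))\<^sup>2 / real CARD('m)" for i
    by (simp add: norm_divide power_divide)
  then show ?thesis
    unfolding norm_vec_def L2_set_def by (simp add: sum_nonneg flip: sum_divide_distrib)
qed

text \<open>On a probability space the second moment is at most the squared bound. This secures
  \<open>\<Theta>\<^sup>2 * s \<ge> 1\<close>, which the level count relies on.\<close>

lemma one_le_sup_bound:
  assumes "prob_space \<rho>" "f \<in> borel_measurable \<rho>" "(LINT x|\<rho>. (cmod (f x))\<^sup>2) = 1"
    and bound: "AE x in \<rho>. cmod (f x) \<le> \<Theta>"
  shows "1 \<le> \<Theta>"
proof -
  interpret prob_space \<rho> by fact
  note assms(2)[measurable]
  have "AE x in \<rho>. 0 \<le> \<Theta>" using bound by eventually_elim (meson norm_ge_zero order_trans)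
  then have \<Theta>: "0 \<le> \<Theta>" by simp
  have sq: "AE x in \<rho>. (cmod (f x))\<^sup>2 \<le> \<Theta>\<^sup>2" using bound by eventually_elim (simp add: power_mono)
  have "1 \<le> (LINT x|\<rho>. \<Theta>\<^sup>2)"
    unfolding assms(3)[symmetric]
    by (intro integral_mono_AE sq integrable_const integrable_const_bound[of _ "\<Theta>\<^sup>2"]) (use sq in auto)
  then have "1\<^sup>2 \<le> \<Theta>\<^sup>2" by (simp add: prob_space)
  then show ?thesis using \<Theta> by (rule power2_le_imp_le)
qed

theorem theorem2p2:
  fixes Uk :: "'d::finite \<Rightarrow> real set"
    and U :: "(real ^ 'd) set"
    and \<rho> :: "(real ^ 'd) measure"
    and J :: "'i set"
    and \<Psi> :: "'i \<Rightarrow> real ^ 'd \<Rightarrow> complex"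
    and \<nu> :: "'n::finite \<Rightarrow> 'i"
    and \<Theta> \<delta> \<gamma> :: real
    and s :: nat
    and P :: "'w measure"
    and y :: "'m::finite \<Rightarrow> 'w \<Rightarrow> real ^ 'd"
  assumes "compact_product_prob_space Uk U \<rho>"
    and "bij_betw \<nu> UNIV J"
    and "orthonormal_system \<rho> J \<Psi>"
    and "uniform_bound \<rho> J \<Psi> = ereal \<Theta>"
    and "0 < \<delta>" and "\<delta> < 1 / 13"
    and "0 < \<gamma>" and "\<gamma> < 1"
    and "s \<ge> 1"
    and "real CARD('m) \<ge>
           2 ^ 6 * exp 1 * (\<Theta>\<^sup>2 * real s / \<delta>\<^sup>2) * ln (\<Theta>\<^sup>2 * real s / \<delta>\<^sup>2) *
           max (2 ^ 5 / \<delta> ^ 4 *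
                  ln (40 * (\<Theta>\<^sup>2 * real s / \<delta>\<^sup>2) * ln (\<Theta>\<^sup>2 * real s / \<delta>\<^sup>2)) *
                  ln (4 * real CARD('n)))
               (1 / \<delta> * ln (1 / (\<gamma> * \<delta>) * ln (\<Theta>\<^sup>2 * real s / \<delta>\<^sup>2)))"
    and "prob_space P"
    and "prob_space.indep_vars P (\<lambda>_. \<rho>) y UNIV"
    and "\<And>i. distr P \<rho> (y i) = \<rho>"
  shows "measure P {\<omega> \<in> space P.
           \<forall>z :: complex ^ 'n. z \<noteq> 0 \<and> card (vec_supp z) \<le> s \<longrightarrow>
             (1 - 13 * \<delta>) * (norm z)\<^sup>2
               < (norm (sampling_matrix \<Psi> \<nu> (\<lambda>i. y i \<omega>) *v z))\<^sup>2 \<and>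
             (norm (sampling_matrix \<Psi> \<nu> (\<lambda>i. y i \<omega>) *v z))\<^sup>2
               < (1 + 13 * \<delta>) * (norm z)\<^sup>2} > 1 - \<gamma>"
    (is "measure P ?T > _")
proof -
  interpret P: prob_space P by fact
  interpret \<rho>: prob_space \<rho> using assms(1) by (simp add: compact_product_prob_space_def)
  have \<nu>: "\<nu> j \<in> J" "\<nu> j = \<nu> k \<longleftrightarrow> j = k" for j k
    using assms(2) by (auto simp: bij_betw_def inj_def)
  have \<Psi>[measurable]: "\<Psi> (\<nu> j) \<in> borel_measurable \<rho>" for j
    using assms(3) \<nu> by (auto simp: orthonormal_system_def)
  have y[measurable]: "y i \<in> P \<rightarrow>\<^sub>M \<rho>" for i
    using assms(12) by (auto simp: P.indep_vars_def)
  have bound: "AE x in \<rho>. cmod (\<Psi> (\<nu> j) x) \<le> \<Theta>" for j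
  proof -
    have "esssup \<rho> (\<lambda>x. ereal (cmod (\<Psi> (\<nu> j) x))) \<le> ereal \<Theta>"
      unfolding assms(4)[symmetric] uniform_bound_def by (rule SUP_upper[OF \<nu>(1)])
    then show ?thesis
      using esssup_AE[where M = \<rho> and f = "\<lambda>x. ereal (cmod (\<Psi> (\<nu> j) x))"]
      by (auto elim!: eventually_mono dest: order_trans)
  qed
  have orth: "(LINT x|\<rho>. \<Psi> (\<nu> j) x * cnj (\<Psi> (\<nu> k) x)) = (if j = k then 1 else 0)" for j k
    using assms(3) \<nu> by (auto simp: orthonormal_system_def)
  have \<Theta>: "1 \<le> \<Theta>"
  proof (rule one_le_sup_bound[OF \<rho>.prob_space_axioms \<Psi> _ bound])
    fix j :: 'n
    have "complex_of_real (LINT x|\<rho>. (cmod (\<Psi> (\<nu> j) x))\<^sup>2) = 1"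
      unfolding integral_complex_of_real[symmetric] complex_norm_square orth by simp
    then show "(LINT x|\<rho>. (cmod (\<Psi> (\<nu> j) x))\<^sup>2) = 1" by simp
  qed
  \<comment> \<open>\<open>\<Theta>\<close> only bounds the essential supremum, so the system is truncated on a null set.\<close>
  define \<phi> where "\<phi> j x = (if cmod (\<Psi> (\<nu> j) x) \<le> \<Theta> then \<Psi> (\<nu> j) x else 0)" for j x
  have \<phi>[measurable]: "\<phi> j \<in> borel_measurable \<rho>" for j
    unfolding \<phi>_def by measurable
  have \<phi>_bound: "cmod (\<phi> j x) \<le> \<Theta>" for j x using \<Theta> by (simp add: \<phi>_def)
  have \<phi>_eq: "AE x in \<rho>. \<phi> j x = \<Psi> (\<nu> j) x" for j
    using bound[of j] by eventually_elim (simp add: \<phi>_def)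
  have [measurable]: "cnj \<in> borel_measurable borel"
    by (intro borel_measurable_continuous_onI continuous_intros)
  have \<phi>_orth: "(LINT x|\<rho>. \<phi> j x * cnj (\<phi> k x)) = (if j = k then 1 else 0)" for j k
    unfolding orth[symmetric]
  proof (rule integral_cong_AE)
    show "AE x in \<rho>. \<phi> j x * cnj (\<phi> k x) = \<Psi> (\<nu> j) x * cnj (\<Psi> (\<nu> k) x)"
      using \<phi>_eq[of j] \<phi>_eq[of k] by eventually_elim simp
  qed measurable
  obtain G where G: "G \<in> sets P" "P.prob G > 1 - \<gamma>"
    "\<And>\<omega> z. \<omega> \<in> G \<Longrightarrow> (\<Sum>j\<in>UNIV. (cmod (z j))\<^sup>2) = 1 \<Longrightarrow> card {j. z j \<noteq> 0} \<le> s \<Longrightarrow>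
       1 - 13 * \<delta> < (\<Sum>i\<in>UNIV. (cmod (\<Sum>j\<in>UNIV. z j * \<phi> j (y i \<omega>)))\<^sup>2) / real CARD('m) \<and>
       (\<Sum>i\<in>UNIV. (cmod (\<Sum>j\<in>UNIV. z j * \<phi> j (y i \<omega>)))\<^sup>2) / real CARD('m) < 1 + 13 * \<delta>"
    using P.restricted_isometry_bounded[OF assms(12,13) \<phi> \<phi>_bound \<Theta> \<phi>_orth assms(5-10)] by blast
  \<comment> \<open>Each sample has law \<open>\<rho>\<close> and so almost surely avoids the null
    sets where truncation changes the system; there are only finitely many pairs of indices.\<close>
  have good: "AE \<omega> in P. \<forall>i. \<forall>j. \<phi> j (y i \<omega>) = \<Psi> (\<nu> j) (y i \<omega>)"
  proof -
    have "AE \<omega> in P. \<phi> j (y i \<omega>) = \<Psi> (\<nu> j) (y i \<omega>)" for i j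
      by (rule AE_distrD[OF y], subst assms(13)) (rule \<phi>_eq)
    then show ?thesis by (simp add: AE_all_countable)
  qed
  \<comment> \<open>\<open>G\<close> lies in the event only up to a null set, so comparing
    probabilities uses measurability of the event itself.\<close>
  have T_meas: "?T \<in> sets P"
  proof -
    have "(\<lambda>\<omega>. sampling_matrix \<Psi> \<nu> (\<lambda>i. y i \<omega>)) \<in> borel_measurable P"
      unfolding sampling_matrix_def by (rule borel_measurable_matrix) measurable
    from measurable_sets[OF this borel_open[OF open_sparse_isometry[of s "1 - 13 * \<delta>" "1 + 13 * \<delta>"]]]
    show ?thesis by (rule back_subst[of "\<lambda>A. A \<in> sets P"]) auto
  qed
  have "AE \<omega> in P. \<omega> \<in> G \<longrightarrow> \<omega> \<in> ?T"
    using good AE_space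
  proof eventually_elim
    case (elim \<omega>)
    show ?case
    proof
      assume \<omega>: "\<omega> \<in> G"
      have unit: "1 - 13 * \<delta> < (norm (sampling_matrix \<Psi> \<nu> (\<lambda>i. y i \<omega>) *v z))\<^sup>2 \<and>
          (norm (sampling_matrix \<Psi> \<nu> (\<lambda>i. y i \<omega>) *v z))\<^sup>2 < 1 + 13 * \<delta>"
        if z: "norm z = 1" "card (vec_supp z) \<le> s" for z
      proof -
        have "(\<Sum>j\<in>UNIV. (cmod (z $ j))\<^sup>2) = (norm z)\<^sup>2"
          by (simp add: norm_vec_def L2_set_def sum_nonneg)
        then show ?thesis
          using G(3)[OF \<omega>, of "($) z"] z elim(1)
          unfolding norm_sampling_matrix by (simp add: vec_supp_def)
      qed
      show "\<omega> \<in> ?T"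
        using elim(2) sparse_homogeneous[OF unit] by blast
    qed
  qed
  then have "P.prob G \<le> P.prob ?T" by (rule P.finite_measure_mono_AE) (rule T_meas)
  with G(2) show ?thesis by simp
qed

end
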